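(* Let $\Phi:\mathbb{T}=\mathbb{S}^1(\tfrac12)\times\mathbb{S}^1(\tfrac12)\to\mathbb{S}^4\subset\mathbb{R}^5$ be the proper biharmonic immersion $\Phi(\gamma,\vartheta)=\big(\tfrac12\cos\gamma,\tfrac12\sin\gamma,\tfrac12\cos\vartheta,\tfrac12\sin\vartheta,\tfrac1{\sqrt2}\big)$, and let $I_2$ be its generalised Jacobi operator. Then $$\mathrm{Ker}(I_2)=W^{(10)}\oplus W^{(1)},$$ where $W^{(10)}$ is a $10$-dimensional subspace spanned by the vector fields $V_i=Z_i\circ\Phi\in\mathcal{C}(\Phi^{-1}T\mathbb{S}^4)$, $i=1,\dots,10$, with $Z_1,\dots,Z_{10}$ the base of Killing fields of $\mathbb{S}^4$ listed in the context, while $\dim W^{(1)}=1$ and $W^{(1)}$ is spanned by $$V_\nu=\tfrac1{\sqrt2}(\cos\gamma,\sin\gamma,-\cos\vartheta,-\sin\vartheta,0).$$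
   Context: $\mathbb{S}^n(R)$ is the Euclidean $n$-sphere of radius $R$, $\mathbb{S}^n=\mathbb{S}^n(1)$; $\mathbb{T}$ carries the product metric $\frac14(d\gamma^2+d\vartheta^2)$ in the angular coordinates $\gamma,\vartheta\in[0,2\pi]$. $\mathcal{C}(\cdot)$ denotes smooth sections. Killing fields on $\mathbb{S}^4$ are restrictions of the following vector fields on $\mathbb{R}^5$ with coordinates $(y^1,\dots,y^5)$: $Z_1=(-y^2,y^1,0,0,0)$, $Z_2=(0,0,-y^4,y^3,0)$, $Z_3=(-y^4,0,0,y^1,0)$, $Z_4=(0,-y^3,y^2,0,0)$, $Z_5=(-y^3,0,y^1,0,0)$, $Z_6=(0,-y^4,0,y^2,0)$, $Z_7=(0,-y^5,0,0,y^2)$, $Z_8=(-y^5,0,0,0,y^1)$, $Z_9=(0,0,0,-y^5,y^4)$, $Z_{10}=(0,0,-y^5,0,y^3)$. For a smooth map $\phi:(M,g)\to(N,h)$ with $M$ compact, $\tau(\phi)=\mathrm{trace}\,\nabla d\phi$ and $E_2(\phi)=\frac12\int_M|\tau(\phi)|^2\,dv_M$; $\phi$ is biharmonic if it is a critical point of $E_2$, and proper biharmonic if moreover $\tau(\phi)\ne 0$. For a biharmonic map $\phi$, the generalised Jacobi operator $I_2=I_2^\phi$ is the fourth-order elliptic self-adjoint operator on $\mathcal{C}(\phi^{-1}TN)$ determined by $$\frac{\partial^2}{\partial t\,\partial s}\Big|_{(0,0)}E_2(\phi_{t,s})=\int_M\langle I_2(V),W\rangle\,dv_M$$ for every smooth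 two-parameter variation $\phi_{t,s}$ of $\phi=\phi_{0,0}$ with $V=\partial_t\phi_{t,0}|_{t=0}$, $W=\partial_s\phi_{0,s}|_{s=0}$. When $N=\mathbb{S}^n$, with $\{e_i\}$ a local orthonormal frame on $M$, $\nabla=\nabla^\phi$ the induced connection on $\phi^{-1}TN$ and $\overline\Delta=-\sum_i(\nabla^\phi_{e_i}\nabla^\phi_{e_i}-\nabla^\phi_{\nabla^M_{e_i}e_i})$, explicitly $$\begin{aligned}I_2(V)=&\ \overline\Delta^2V+\overline\Delta\Big(\sum_i\langle V,d\phi(e_i)\rangle d\phi(e_i)-|d\phi|^2V\Big)+2\sum_i\langle\nabla_{e_i}\tau(\phi),d\phi(e_i)\rangle V+|\tau(\phi)|^2V\\&-2\sum_i\langle V,\nabla_{e_i}\tau(\phi)\rangle d\phi(e_i)-2\sum_i\langle\tau(\phi),\nabla_{e_i}V\rangle d\phi(e_i)-\langle\tau(\phi),V\rangle\tau(\phi)\\&+\sum_i\langle d\phi(e_i),\overline\Delta V\rangle d\phi(e_i)+\sum_{i,j}\langle V,d\phi(e_j)\rangle\langle d\phi(e_i),d\phi(e_j)\rangle d\phi(e_i)\\&-2|d\phi|^2\sum_i\langle d\phi(e_i),V\rangle d\phi(e_i)+2\sum_i\langle\nabla_{e_i}V,d\phi(e_i)\rangle\tau(\phi)-|d\phi|^2\overline\Delta V+|d\phi|^4V.\end{aligned}$$ *)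

theory Defs
  imports "HOL-Analysis.Analysis" "HOL-Library.Function_Algebras"
begin

text \<open>Pointwise real vector space structure on functions, so that the library's
  \<^const>\<open>span\<close> and \<^const>\<open>dim\<close> apply to spaces of vector fields along a map.\<close>

instantiation "fun" :: (type, real_vector) real_vector
begin

definition scaleR_fun :: "real \<Rightarrow> ('a \<Rightarrow> 'b) \<Rightarrow> 'a \<Rightarrow> 'b"
  where "scaleR_fun c f = (\<lambda>x. c *\<^sub>R f x)"

instance
  by standard (simp_all add: scaleR_fun_def fun_eq_iff scaleR_add_right scaleR_add_left)

end

primrec C_k :: "nat \<Rightarrow> ('a::euclidean_space \<Rightarrow> 'b::real_normed_vector) \<Rightarrow> bool" where
  "C_k 0 f \<longleftrightarrow> continuous_on UNIV f"
| "C_k (Suc k) f \<longleftrightarrow>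
     (\<forall>x. f differentiable (at x)) \<and> (\<forall>v. C_k k (\<lambda>x. frechet_derivative f (at x) v))"

definition smooth :: "('a::euclidean_space \<Rightarrow> 'b::real_normed_vector) \<Rightarrow> bool"
  where "smooth f \<longleftrightarrow> (\<forall>k. C_k k f)"


section \<open>Maps from the torus to a unit sphere\<close>

text \<open>The torus is handled in its angular coordinates \<open>(\<gamma>, \<theta>)\<close>: maps and sections on it are
  the functions on the coordinate plane that are \<open>2\<pi>\<close>-periodic in each variable.  A map \<open>\<phi>\<close> into
  the unit sphere is viewed as a map into the ambient Euclidean space, and a section of
  \<open>\<phi>\<^sup>-\<^sup>1 T S\<^sup>n\<close> is a smooth vector-valued function orthogonal to \<open>\<phi>\<close> at each point.\<close>

type_synonym torus = "real \<times> real"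

definition doubly_periodic :: "(torus \<Rightarrow> 'a) \<Rightarrow> bool" where
  "doubly_periodic f \<longleftrightarrow>
     (\<forall>\<gamma> \<theta>. f (\<gamma> + 2 * pi, \<theta>) = f (\<gamma>, \<theta>) \<and> f (\<gamma>, \<theta> + 2 * pi) = f (\<gamma>, \<theta>))"

definition sections :: "(torus \<Rightarrow> 'a::euclidean_space) \<Rightarrow> (torus \<Rightarrow> 'a) set" where
  "sections \<phi> = {V. smooth V \<and> doubly_periodic V \<and> (\<forall>p. V p \<bullet> \<phi> p = 0)}"

definition torus_metric :: "real \<times> real \<Rightarrow> real \<times> real \<Rightarrow> real" where
  "torus_metric X Y = (fst X * fst Y + snd X * snd Y) / 4"

text \<open>The global orthonormal frame \<open>2 \<partial>/\<partial>\<gamma>, 2 \<partial>/\<partial>\<theta>\<close>.  The metric has constant coefficients in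
  these coordinates, so the frame is parallel: the terms \<open>\<nabla>\<^sup>M\<^sub>e e\<close> in the tension field and in the
  rough Laplacian vanish.\<close>

definition frame :: "(real \<times> real) set" where
  "frame = {(2, 0), (0, 2)}"

lemma frame_orthonormal:
  "e \<in> frame \<Longrightarrow> e' \<in> frame \<Longrightarrow> torus_metric e e' = (if e = e' then 1 else 0)"
  by (auto simp: frame_def torus_metric_def)

text \<open>Derivative of \<open>f\<close> in the constant direction \<open>X\<close>; \<open>dir_deriv X \<phi>\<close> is \<open>d\<phi>(X)\<close>.\<close>

definition dir_deriv :: "real \<times> real \<Rightarrow> (torus \<Rightarrow> 'a::euclidean_space) \<Rightarrow> torus \<Rightarrow> 'a" where
  "dir_deriv X f p = frechet_derivative f (at p) X"

text \<open>The connection induced on the pull-back bundle by the Levi-Civita connection of the sphere: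
  the ambient derivative projected onto the orthogonal complement of the unit vector \<open>\<phi> p\<close>.\<close>

definition conn ::
  "(torus \<Rightarrow> 'a::euclidean_space) \<Rightarrow> real \<times> real \<Rightarrow> (torus \<Rightarrow> 'a) \<Rightarrow> torus \<Rightarrow> 'a" where
  "conn \<phi> X V p = dir_deriv X V p - (dir_deriv X V p \<bullet> \<phi> p) *\<^sub>R \<phi> p"

definition tension :: "(torus \<Rightarrow> 'a::euclidean_space) \<Rightarrow> torus \<Rightarrow> 'a" where
  "tension \<phi> p = (\<Sum>e\<in>frame. conn \<phi> e (dir_deriv e \<phi>) p)"

definition rough_laplacian ::
  "(torus \<Rightarrow> 'a::euclidean_space) \<Rightarrow> (torus \<Rightarrow> 'a) \<Rightarrow> torus \<Rightarrow> 'a" where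
  "rough_laplacian \<phi> V p = - (\<Sum>e\<in>frame. conn \<phi> e (conn \<phi> e V) p)"

definition norm_d_sq :: "(torus \<Rightarrow> 'a::euclidean_space) \<Rightarrow> torus \<Rightarrow> real" where
  "norm_d_sq \<phi> p = (\<Sum>e\<in>frame. dir_deriv e \<phi> p \<bullet> dir_deriv e \<phi> p)"

text \<open>The generalised Jacobi operator of the bienergy for a map into a unit sphere.\<close>

definition I2 :: "(torus \<Rightarrow> 'a::euclidean_space) \<Rightarrow> (torus \<Rightarrow> 'a) \<Rightarrow> torus \<Rightarrow> 'a" where
  "I2 \<phi> V p =
     (let d = (\<lambda>e. dir_deriv e \<phi> p);
          \<tau> = tension \<phi>;
          \<Delta> = rough_laplacian \<phi>
      in \<Delta> (\<Delta> V) p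
       + \<Delta> (\<lambda>q. (\<Sum>e\<in>frame. (V q \<bullet> dir_deriv e \<phi> q) *\<^sub>R dir_deriv e \<phi> q)
                - norm_d_sq \<phi> q *\<^sub>R V q) p
       + (2 * (\<Sum>e\<in>frame. conn \<phi> e \<tau> p \<bullet> d e)) *\<^sub>R V p
       + (\<tau> p \<bullet> \<tau> p) *\<^sub>R V p
       - 2 *\<^sub>R (\<Sum>e\<in>frame. (V p \<bullet> conn \<phi> e \<tau> p) *\<^sub>R d e)
       - 2 *\<^sub>R (\<Sum>e\<in>frame. (\<tau> p \<bullet> conn \<phi> e V p) *\<^sub>R d e)
       - (\<tau> p \<bullet> V p) *\<^sub>R \<tau> p
       + (\<Sum>e\<in>frame. (d e \<bullet> \<Delta> V p) *\<^sub>R d e)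
       + (\<Sum>e\<in>frame. \<Sum>e'\<in>frame. ((V p \<bullet> d e') * (d e \<bullet> d e')) *\<^sub>R d e)
       - (2 * norm_d_sq \<phi> p) *\<^sub>R (\<Sum>e\<in>frame. (d e \<bullet> V p) *\<^sub>R d e)
       + (2 * (\<Sum>e\<in>frame. conn \<phi> e V p \<bullet> d e)) *\<^sub>R \<tau> p
       - norm_d_sq \<phi> p *\<^sub>R \<Delta> V p
       + (norm_d_sq \<phi> p)\<^sup>2 *\<^sub>R V p)"

definition Ker_I2 :: "(torus \<Rightarrow> 'a::euclidean_space) \<Rightarrow> (torus \<Rightarrow> 'a) set" where
  "Ker_I2 \<phi> = {V \<in> sections \<phi>. \<forall>p. I2 \<phi> V p = 0}"


section \<open>The biharmonic torus and the vector fields\<close>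

definition \<Phi> :: "torus \<Rightarrow> real ^ 5" where
  "\<Phi> = (\<lambda>(\<gamma>, \<theta>). vector [cos \<gamma> / 2, sin \<gamma> / 2, cos \<theta> / 2, sin \<theta> / 2, 1 / sqrt 2])"

definition Z :: "nat \<Rightarrow> real ^ 5 \<Rightarrow> real ^ 5" where
  "Z i y =
     [vector [- y$2, y$1, 0, 0, 0],
      vector [0, 0, - y$4, y$3, 0],
      vector [- y$4, 0, 0, y$1, 0],
      vector [0, - y$3, y$2, 0, 0],
      vector [- y$3, 0, y$1, 0, 0],
      vector [0, - y$4, 0, y$2, 0],
      vector [0, - y$5, 0, 0, y$2],
      vector [- y$5, 0, 0, 0, y$1],
      vector [0, 0, 0, - y$5, y$4],
      vector [0, 0, - y$5, 0, y$3]] ! (i - 1)"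

definition V\<^sub>\<nu> :: "torus \<Rightarrow> real ^ 5" where
  "V\<^sub>\<nu> = (\<lambda>(\<gamma>, \<theta>). (1 / sqrt 2) *\<^sub>R vector [cos \<gamma>, sin \<gamma>, - cos \<theta>, - sin \<theta>, 0])"

definition W10 :: "(torus \<Rightarrow> real ^ 5) set" where
  "W10 = span ((\<lambda>i. Z i \<circ> \<Phi>) ` {1..10})"

definition W1 :: "(torus \<Rightarrow> real ^ 5) set" where
  "W1 = span {V\<^sub>\<nu>}"

end

theory Submission
  imports Defs
begin

text \<open>
  In the orthogonal frame \<open>X1, X2, \<eta>, N\<close> of \<open>\<Phi>\<^sup>-\<^sup>1 T S\<^sup>4\<close> (\<open>X1, X2\<close> the images of the orthonormal
  frame of the torus, \<open>\<eta> = \<tau>(\<Phi>) / 2\<close>, and \<open>N = sqrt 2 V\<^sub>\<nu>\<close> of squared length two), the operator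
  \<open>I\<^sub>2\<close> has constant coefficients.  It
  therefore acts on the Fourier coefficients of the frame components of a section mode by mode: for the
  frequencies \<open>(m, n)\<close> the coefficients solve a \<open>4 \<times> 4\<close> linear system whose matrix depends only on
  \<open>m\<^sup>2\<close> and \<open>n\<^sup>2\<close>.  Its determinant is positive as soon as \<open>m\<^sup>2 + n\<^sup>2 \<ge> 4\<close>, and in the remaining modes,
  those with \<open>m, n \<le> 1\<close>, the solutions are accounted for by the eleven given fields.  These fields are
  pairwise \<open>L\<^sup>2\<close>-orthogonal, so subtracting from a kernel element its projection onto their span
  leaves a kernel element all of whose Fourier coefficients vanish; by the Stone-Weierstrass theorem it
  is zero.
\<close>

section \<open>Smooth functions and directional derivatives\<close>

text \<open>The coefficients are constant by symmetry: translating an angle of the torus corresponds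
  to rotating the plane of the first two or of the next two ambient coordinates, and \<Phi> and the
  four frame fields are equivariant under these rotations. Complex exponentials are avoided: a mode
  is a pair of real functions with f'' = - m^2 f and g'' = - n^2 g, and the components along
  \<open>X1\<close>, \<open>X2\<close>, \<open>\<eta>\<close>, \<open>N\<close> are tested against
  f' g, f g', f g, f g respectively. This closes the system on four real unknowns. The price is that
  f' or g' vanishes at frequency zero, so the part of the \<open>X1\<close>-component independent of
  the first angle and the part of the \<open>X2\<close>-component independent of the second are
  invisible to the system and need an argument of their own. For each choice of f and g among cos,
  sin and 1, an exceptional mode leaves one free unknown, except that the constant mode leaves three
  free means. This gives 4 + 2 + 2 + 3 = 11, and orthogonality to the eleven fields supplies exactly
  the missing equations.\<close>

lemma C_k_SucD: "C_k (Suc k) f \<Longrightarrow> C_k k f"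
proof (induction k arbitrary: f)
  case 0
  then show ?case
    by (auto simp: continuous_on_eq_continuous_at intro!: differentiable_imp_continuous_within)
next
  case (Suc k)
  then show ?case by (metis C_k.simps(2))
qed

text \<open>By uniqueness of the derivative, an explicitly computed f' can stand in for
  \<open>frechet_derivative\<close>; the regularity inductions below go through this rule.\<close>

lemma C_k_SucI:
  assumes "\<And>x. (f has_derivative f' x) (at x)" "\<And>v. C_k k (\<lambda>x. f' x v)"
  shows "C_k (Suc k) f"
proof -
  have "frechet_derivative f (at x) = f' x" for x
    using frechet_derivative_at[OF assms(1)] by simp
  then show ?thesis
    using assms by (auto simp: differentiable_def)
qed

lemma C_k_const: "C_k k (\<lambda>x. c)"
proof (induction k arbitrary: c)
  case (Suc k)
  then show ?case by (intro C_k_SucI[where f' = "\<lambda>x v. 0"]) auto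
qed auto

lemma has_derivative_C_k_Suc:
  "C_k (Suc k) f \<Longrightarrow> (f has_derivative frechet_derivative f (at x)) (at x)"
  using frechet_derivative_works by fastforce

lemma C_k_add: "C_k k f \<Longrightarrow> C_k k g \<Longrightarrow> C_k k (\<lambda>x. f x + g x)"
proof (induction k arbitrary: f g)
  case 0
  then show ?case by (auto intro: continuous_intros)
next
  case (Suc k)
  show ?case
    by (rule C_k_SucI, rule has_derivative_add[OF has_derivative_C_k_Suc[OF Suc.prems(1)]
          has_derivative_C_k_Suc[OF Suc.prems(2)]])
       (use Suc in auto)
qed

text \<open>The product rule gives a sum of two products of the same kind, one factor differentiated
  and the other weakened by \<open>C_k_SucD\<close>; hence both factors stay arbitrary in the
  induction. One proof serves scaling, inner product and multiplication.\<close>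

lemma (in bounded_bilinear) C_k_bilinear:
  "C_k k f \<Longrightarrow> C_k k g \<Longrightarrow> C_k k (\<lambda>x. prod (f x) (g x))"
proof (induction k arbitrary: f g)
  case 0
  then show ?case by (auto intro: continuous_on)
next
  case (Suc k)
  show ?case
    by (rule C_k_SucI, rule FDERIV[OF has_derivative_C_k_Suc[OF Suc.prems(1)]
          has_derivative_C_k_Suc[OF Suc.prems(2)]], rule C_k_add; rule Suc.IH)
       (use Suc.prems C_k_SucD in auto)
qed

lemma smooth_const [simp]: "smooth (\<lambda>x. c)"
  by (simp add: smooth_def C_k_const)

lemma smooth_add [simp]: "smooth f \<Longrightarrow> smooth g \<Longrightarrow> smooth (\<lambda>x. f x + g x)"
  by (simp add: smooth_def C_k_add)

lemma smooth_scaleR [simp]: "smooth f \<Longrightarrow> smooth g \<Longrightarrow> smooth (\<lambda>x. f x *\<^sub>R g x)"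
  by (simp add: smooth_def bounded_bilinear.C_k_bilinear[OF bounded_bilinear_scaleR])

lemma smooth_inner [simp]: "smooth f \<Longrightarrow> smooth g \<Longrightarrow> smooth (\<lambda>x. f x \<bullet> g x)"
  by (simp add: smooth_def bounded_bilinear.C_k_bilinear[OF bounded_bilinear_inner])

lemma smooth_mult [simp]:
  "smooth f \<Longrightarrow> smooth g \<Longrightarrow> smooth (\<lambda>x. f x * (g x :: 'a::real_normed_algebra))"
  by (simp add: smooth_def bounded_bilinear.C_k_bilinear[OF bounded_bilinear_mult])

lemma smooth_minus [simp]:
  assumes "smooth f" shows "smooth (\<lambda>x. - f x)"
  using smooth_scaleR[OF smooth_const[of "-1"] assms] by simp

lemma smooth_diff [simp]: "smooth f \<Longrightarrow> smooth g \<Longrightarrow> smooth (\<lambda>x. f x - g x)"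
  using smooth_add[OF _ smooth_minus] by fastforce

lemma smooth_continuous: "smooth f \<Longrightarrow> continuous_on UNIV f"
  by (metis C_k.simps(1) smooth_def)

lemma smooth_differentiable: "smooth f \<Longrightarrow> f differentiable at x"
  by (metis C_k.simps(2) smooth_def)

lemma smooth_has_derivative: "smooth f \<Longrightarrow> (f has_derivative frechet_derivative f (at x)) (at x)"
  using smooth_differentiable frechet_derivative_works by blast

lemma smooth_dir_deriv [simp]: "smooth f \<Longrightarrow> smooth (dir_deriv X f)"
proof -
  assume "smooth f"
  then have "C_k k (\<lambda>x. frechet_derivative f (at x) X)" for k
    unfolding smooth_def by (metis C_k.simps(2))
  then show ?thesis by (simp add: smooth_def dir_deriv_def[abs_def])
qed

lemma dir_deriv_eqI: "(f has_derivative f') (at p) \<Longrightarrow> dir_deriv X f p = f' X"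
  unfolding dir_deriv_def using frechet_derivative_at by metis

lemma dir_deriv_const [simp]: "dir_deriv X (\<lambda>p. c) = (\<lambda>p. 0)"
  by (rule ext, rule dir_deriv_eqI) auto

lemma dir_deriv_add [simp]:
  assumes "smooth f" "smooth g"
  shows "dir_deriv X (\<lambda>p. f p + g p) = (\<lambda>p. dir_deriv X f p + dir_deriv X g p)"
  by (rule ext, subst dir_deriv_eqI[OF has_derivative_add[OF assms[THEN smooth_has_derivative]]])
     (simp add: dir_deriv_def)

lemma dir_deriv_scaleR:
  assumes "smooth f" "smooth g"
  shows "dir_deriv X (\<lambda>p. f p *\<^sub>R g p) =
    (\<lambda>p. f p *\<^sub>R dir_deriv X g p + dir_deriv X f p *\<^sub>R g p)"
  by (rule ext, subst dir_deriv_eqI[OF has_derivative_scaleR[OF assms[THEN smooth_has_derivative]]])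
     (simp add: dir_deriv_def)

lemma dir_deriv_cmult [simp]:
  fixes f :: "torus \<Rightarrow> real"
  shows "smooth f \<Longrightarrow> dir_deriv X (\<lambda>p. c * f p) = (\<lambda>p. c * dir_deriv X f p)"
  using dir_deriv_scaleR[of "\<lambda>p. c" f] by simp

lemma dir_deriv_minus [simp]:
  "smooth f \<Longrightarrow> dir_deriv X (\<lambda>p. - f p) = (\<lambda>p. - dir_deriv X f p)"
  using dir_deriv_scaleR[of "\<lambda>p. -1" f] by simp

lemma dir_deriv_diff [simp]:
  "smooth f \<Longrightarrow> smooth g \<Longrightarrow>
    dir_deriv X (\<lambda>p. f p - g p) = (\<lambda>p. dir_deriv X f p - dir_deriv X g p)"
  using dir_deriv_add[of f "\<lambda>p. - g p"] by simp

section \<open>Periodic solutions of f'' = - m^2 f and their products over the two angles\<close>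

definition trig_pair :: "nat \<Rightarrow> (real \<Rightarrow> real) \<Rightarrow> (real \<Rightarrow> real) \<Rightarrow> bool" where
  "trig_pair m f f' \<longleftrightarrow>
     (\<forall>x. (f has_real_derivative f' x) (at x)) \<and>
     (\<forall>x. (f' has_real_derivative - ((real m)\<^sup>2 * f x)) (at x)) \<and>
     (\<forall>x. f (x + 2 * pi) = f x) \<and> (\<forall>x. f' (x + 2 * pi) = f' x)"

text \<open>Makes f' a test function of the same frequency, so that a coefficient against f can be
  recovered, up to the factor - m^2, from one against f''.\<close>

lemma trig_pair_deriv:
  "trig_pair m f f' \<Longrightarrow> trig_pair m f' (\<lambda>x. - ((real m)\<^sup>2 * f x))"
  unfolding trig_pair_def by (auto intro!: derivative_eq_intros)

lemma trig_pair_const: "trig_pair 0 (\<lambda>x. c) (\<lambda>x. 0)"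
  by (auto simp: trig_pair_def)

lemma trig_pair_cos: "trig_pair m (\<lambda>x. cos (real m * x + \<phi>)) (\<lambda>x. - (real m * sin (real m * x + \<phi>)))"
proof -
  have *: "real m * (x + 2 * pi) + \<phi> = (real m * x + \<phi>) + 2 * real m * pi" for x
    by (simp add: algebra_simps)
  have "cos (real m * (x + 2 * pi) + \<phi>) = cos (real m * x + \<phi>)"
       "sin (real m * (x + 2 * pi) + \<phi>) = sin (real m * x + \<phi>)" for x
    unfolding * by (simp_all add: cos_add sin_add)
  then show ?thesis
    by (auto simp: trig_pair_def power2_eq_square intro!: derivative_eq_intros)
qed

lemma trig_pair_has_derivative:
  assumes "trig_pair m f f'" "bounded_linear l"
  shows "((\<lambda>p. f (l p)) has_derivative (\<lambda>v. l v * f' (l p))) (at p)"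
  using assms DERIV_compose_FDERIV bounded_linear_imp_has_derivative
  unfolding trig_pair_def by blast

text \<open>The derivative in direction v is l v times f' composed with l, and f' heads a
  \<open>trig_pair\<close> again; this is why the induction runs over all pairs of frequency m at
  once.\<close>

lemma smooth_trig_pair:
  fixes l :: "torus \<Rightarrow> real"
  assumes "trig_pair m f f'" "bounded_linear l"
  shows "smooth (\<lambda>p. f (l p))"
proof -
  have "C_k k (\<lambda>p. f (l p))" if "trig_pair m f f'" for k f f'
    using that
  proof (induction k arbitrary: f f')
    case 0
    show ?case
      using has_derivative_continuous[OF trig_pair_has_derivative[OF 0 assms(2)]]
      by (simp add: continuous_at_imp_continuous_on)
  next
    case (Suc k)
    show ?case
      by (rule C_k_SucI, rule trig_pair_has_derivative[OF Suc.prems assms(2)])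
         (intro bounded_bilinear.C_k_bilinear[OF bounded_bilinear_mult] C_k_const
           Suc.IH[OF trig_pair_deriv[OF Suc.prems]])
  qed
  then show ?thesis using assms by (auto simp: smooth_def)
qed

abbreviation "D1 \<equiv> dir_deriv (2, 0)"
abbreviation "D2 \<equiv> dir_deriv (0, 2)"

lemma trig_prod_has_derivative:
  assumes "trig_pair m f f'" "trig_pair n g g'"
  shows "((\<lambda>p. f (fst p) * g (snd p)) has_derivative
     (\<lambda>v. f (fst p) * (snd v * g' (snd p)) + fst v * f' (fst p) * g (snd p))) (at p)"
  by (rule has_derivative_mult trig_pair_has_derivative assms bounded_linear_fst bounded_linear_snd)+

definition tensor :: "(real \<Rightarrow> real) \<Rightarrow> (real \<Rightarrow> real) \<Rightarrow> torus \<Rightarrow> real" where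
  "tensor f g p = f (fst p) * g (snd p)"

lemma D_tensor:
  assumes "trig_pair m f f'" "trig_pair n g g'"
  shows "D1 (tensor f g) = (\<lambda>p. 2 * tensor f' g p)" "D2 (tensor f g) = (\<lambda>p. 2 * tensor f g' p)"
  unfolding tensor_def[abs_def]
  by (rule ext, subst dir_deriv_eqI[OF trig_prod_has_derivative[OF assms]], simp)+

lemma smooth_tensor:
  assumes "trig_pair m f f'" "trig_pair n g g'"
  shows "smooth (tensor f g)"
  unfolding tensor_def[abs_def]
  by (intro smooth_mult smooth_trig_pair[OF assms(1)] smooth_trig_pair[OF assms(2)] bounded_linear_fst bounded_linear_snd)

section \<open>The adapted frame along \<open>\<Phi>\<close>\<close>

definition E :: "5 \<Rightarrow> real ^ 5" where "E i = axis i 1"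

lemma inner_E [simp]: "E i \<bullet> E j = (if i = j then 1 else 0)"
  by (auto simp: E_def inner_axis_axis)

lemma exhaust_5: "(i :: 5) = 1 \<or> i = 2 \<or> i = 3 \<or> i = 4 \<or> i = 5"
proof (induct i)
  case (of_int z)
  then have "z = 0 \<or> z = 1 \<or> z = 2 \<or> z = 3 \<or> z = 4" by fastforce
  then show ?case by auto
qed

lemma forall_5: "(\<forall>i :: 5. P i) \<longleftrightarrow> P 1 \<and> P 2 \<and> P 3 \<and> P 4 \<and> P 5"
  by (metis exhaust_5)

lemma vector_5 [simp]:
  "(vector [a, b, c, d, e] :: real ^ 5) $ 1 = a"
  "(vector [a, b, c, d, e] :: real ^ 5) $ 2 = b"
  "(vector [a, b, c, d, e] :: real ^ 5) $ 3 = c"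
  "(vector [a, b, c, d, e] :: real ^ 5) $ 4 = d"
  "(vector [a, b, c, d, e] :: real ^ 5) $ 5 = e"
  by (simp_all add: vector_def)

lemma vector_eq_E:
  "(vector [a, b, c, d, e] :: real ^ 5) =
     a *\<^sub>R E 1 + b *\<^sub>R E 2 + c *\<^sub>R E 3 + d *\<^sub>R E 4 + e *\<^sub>R E 5"
  by (simp add: vec_eq_iff forall_5 E_def axis_def)

text \<open>\<open>n1\<close>, \<open>n2\<close> are the outward unit normals of the two circles in
  their planes; \<open>X1\<close>, \<open>X2\<close> are the unit tangents.\<close>

definition n1 :: "torus \<Rightarrow> real ^ 5" where "n1 p = cos (fst p) *\<^sub>R E 1 + sin (fst p) *\<^sub>R E 2"
definition n2 :: "torus \<Rightarrow> real ^ 5" where "n2 p = cos (snd p) *\<^sub>R E 3 + sin (snd p) *\<^sub>R E 4"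
definition X1 :: "torus \<Rightarrow> real ^ 5" where "X1 p = - sin (fst p) *\<^sub>R E 1 + cos (fst p) *\<^sub>R E 2"
definition X2 :: "torus \<Rightarrow> real ^ 5" where "X2 p = - sin (snd p) *\<^sub>R E 3 + cos (snd p) *\<^sub>R E 4"

definition \<eta> :: "torus \<Rightarrow> real ^ 5" where
  "\<eta> p = (- 1 / 2) *\<^sub>R n1 p + (- 1 / 2) *\<^sub>R n2 p + (1 / sqrt 2) *\<^sub>R E 5"
text \<open>Left unnormalised: with squared length two, the connection has integer coefficients in
  the frame. In return, a factor 2 enters inner products of \<open>N\<close>-components, and
  expanding a section requires division by 2.\<close>

definition N :: "torus \<Rightarrow> real ^ 5" where "N p = n1 p - n2 p"

lemma \<Phi>_eq: "\<Phi> p = (1 / 2) *\<^sub>R n1 p + (1 / 2) *\<^sub>R n2 p + (1 / sqrt 2) *\<^sub>R E 5"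
  by (cases p) (simp add: \<Phi>_def vector_eq_E n1_def n2_def algebra_simps)

lemma inner_base [simp]:
  "n1 p \<bullet> n1 p = 1" "n2 p \<bullet> n2 p = 1" "X1 p \<bullet> X1 p = 1" "X2 p \<bullet> X2 p = 1"
  "n1 p \<bullet> n2 p = 0" "n2 p \<bullet> n1 p = 0" "n1 p \<bullet> X1 p = 0" "X1 p \<bullet> n1 p = 0"
  "n1 p \<bullet> X2 p = 0" "X2 p \<bullet> n1 p = 0" "n2 p \<bullet> X1 p = 0" "X1 p \<bullet> n2 p = 0"
  "n2 p \<bullet> X2 p = 0" "X2 p \<bullet> n2 p = 0" "X1 p \<bullet> X2 p = 0" "X2 p \<bullet> X1 p = 0"
  "n1 p \<bullet> E 5 = 0" "E 5 \<bullet> n1 p = 0" "n2 p \<bullet> E 5 = 0" "E 5 \<bullet> n2 p = 0"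
  "X1 p \<bullet> E 5 = 0" "E 5 \<bullet> X1 p = 0" "X2 p \<bullet> E 5 = 0" "E 5 \<bullet> X2 p = 0"
  by (simp_all add: n1_def n2_def X1_def X2_def inner_add_left inner_add_right
      inner_diff_left inner_diff_right flip: power2_eq_square)

lemma inner_frame [simp]:
  "\<eta> p \<bullet> \<eta> p = 1" "N p \<bullet> N p = 2" "\<Phi> p \<bullet> \<Phi> p = 1"
  "X1 p \<bullet> \<eta> p = 0" "\<eta> p \<bullet> X1 p = 0" "X2 p \<bullet> \<eta> p = 0" "\<eta> p \<bullet> X2 p = 0"
  "X1 p \<bullet> N p = 0" "N p \<bullet> X1 p = 0" "X2 p \<bullet> N p = 0" "N p \<bullet> X2 p = 0"
  "\<eta> p \<bullet> N p = 0" "N p \<bullet> \<eta> p = 0" "X1 p \<bullet> \<Phi> p = 0" "\<Phi> p \<bullet> X1 p = 0"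
  "X2 p \<bullet> \<Phi> p = 0" "\<Phi> p \<bullet> X2 p = 0" "\<eta> p \<bullet> \<Phi> p = 0" "\<Phi> p \<bullet> \<eta> p = 0"
  "N p \<bullet> \<Phi> p = 0" "\<Phi> p \<bullet> N p = 0"
  by (simp_all add: \<eta>_def N_def \<Phi>_eq inner_add_left inner_add_right
      inner_diff_left inner_diff_right real_div_sqrt)

lemma trig_pair_simple:
  "trig_pair 1 cos (\<lambda>x. - sin x)" "trig_pair 1 sin cos"
  by (auto simp: trig_pair_def intro!: derivative_eq_intros)

lemma smooth_frame [simp]:
  "smooth n1" "smooth n2" "smooth X1" "smooth X2" "smooth \<eta>" "smooth N"
proof -
  have "smooth (\<lambda>p::torus. cos (fst p))" "smooth (\<lambda>p::torus. sin (fst p))"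
       "smooth (\<lambda>p::torus. cos (snd p))" "smooth (\<lambda>p::torus. sin (snd p))"
    by (rule smooth_trig_pair trig_pair_simple bounded_linear_fst bounded_linear_snd)+
  note [simp] = this
  show [simp]: "smooth n1" "smooth n2" "smooth X1" "smooth X2"
    by (simp_all add: n1_def[abs_def] n2_def[abs_def] X1_def[abs_def] X2_def[abs_def])
  show "smooth \<eta>" "smooth N"
    by (simp_all add: \<eta>_def[abs_def] N_def[abs_def])
qed

lemma D_base [simp]:
  "D1 n1 p = 2 *\<^sub>R X1 p" "D2 n1 p = 0" "D1 X1 p = - 2 *\<^sub>R n1 p" "D2 X1 p = 0"
  "D1 n2 p = 0" "D2 n2 p = 2 *\<^sub>R X2 p" "D1 X2 p = 0" "D2 X2 p = - 2 *\<^sub>R n2 p"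
proof -
  have "(n1 has_derivative (\<lambda>v. fst v *\<^sub>R X1 p)) (at p)"
    "(X1 has_derivative (\<lambda>v. - fst v *\<^sub>R n1 p)) (at p)"
    "(n2 has_derivative (\<lambda>v. snd v *\<^sub>R X2 p)) (at p)"
    "(X2 has_derivative (\<lambda>v. - snd v *\<^sub>R n2 p)) (at p)"
    unfolding n1_def[abs_def] n2_def[abs_def] X1_def[abs_def] X2_def[abs_def]
    by (auto intro!: derivative_eq_intros simp: fun_eq_iff algebra_simps)
  note d = this[THEN dir_deriv_eqI]
  show "D1 n1 p = 2 *\<^sub>R X1 p" "D2 n1 p = 0" "D1 X1 p = - 2 *\<^sub>R n1 p" "D2 X1 p = 0"
  "D1 n2 p = 0" "D2 n2 p = 2 *\<^sub>R X2 p" "D1 X2 p = 0" "D2 X2 p = - 2 *\<^sub>R n2 p"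
    by (simp_all add: d)
qed

lemma D_frame [simp]:
  "D1 \<eta> p = - X1 p" "D2 \<eta> p = - X2 p" "D1 N p = 2 *\<^sub>R X1 p" "D2 N p = - 2 *\<^sub>R X2 p"
  "D1 \<Phi> = X1" "D2 \<Phi> = X2"
  by (simp_all add: \<eta>_def[abs_def] N_def[abs_def] \<Phi>_eq[abs_def] dir_deriv_scaleR fun_eq_iff)

text \<open>Solves n1 + n2 = \<Phi> - \<eta> and n1 - n2 = N. It splits the derivatives of the
  tangents, which are multiples of \<open>n1\<close> and \<open>n2\<close>, into a part along \<Phi>
  and a part in the frame.\<close>

lemma n_eq:
  "n1 p = (1 / 2) *\<^sub>R \<Phi> p - (1 / 2) *\<^sub>R \<eta> p + (1 / 2) *\<^sub>R N p"
  "n2 p = (1 / 2) *\<^sub>R \<Phi> p - (1 / 2) *\<^sub>R \<eta> p - (1 / 2) *\<^sub>R N p"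
proof -
  show "n1 p = (1 / 2) *\<^sub>R \<Phi> p - (1 / 2) *\<^sub>R \<eta> p + (1 / 2) *\<^sub>R N p"
  "n2 p = (1 / 2) *\<^sub>R \<Phi> p - (1 / 2) *\<^sub>R \<eta> p - (1 / 2) *\<^sub>R N p"
    by (simp_all add: \<Phi>_eq \<eta>_def N_def vec_eq_iff field_simps)
qed

definition frame_field ::
  "(torus \<Rightarrow> real) \<Rightarrow> (torus \<Rightarrow> real) \<Rightarrow> (torus \<Rightarrow> real) \<Rightarrow> (torus \<Rightarrow> real) \<Rightarrow> torus \<Rightarrow> real ^ 5"
  where "frame_field a b c d p = a p *\<^sub>R X1 p + b p *\<^sub>R X2 p + c p *\<^sub>R \<eta> p + d p *\<^sub>R N p"

lemma inner_frame_field [simp]: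
  "frame_field a b c d p \<bullet> X1 p = a p" "frame_field a b c d p \<bullet> X2 p = b p" "frame_field a b c d p \<bullet> \<eta> p = c p"
  "frame_field a b c d p \<bullet> N p = 2 * d p" "frame_field a b c d p \<bullet> \<Phi> p = 0"
  "X1 p \<bullet> frame_field a b c d p = a p" "X2 p \<bullet> frame_field a b c d p = b p" "\<eta> p \<bullet> frame_field a b c d p = c p"
  "N p \<bullet> frame_field a b c d p = 2 * d p" "\<Phi> p \<bullet> frame_field a b c d p = 0"
  by (simp_all add: frame_field_def inner_add_left inner_add_right)

lemma smooth_frame_field [simp]:
  "smooth a \<Longrightarrow> smooth b \<Longrightarrow> smooth c \<Longrightarrow> smooth d \<Longrightarrow> smooth (frame_field a b c d)"
  by (simp add: frame_field_def[abs_def])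

lemma conn_frame_field:
  assumes [simp]: "smooth a" "smooth b" "smooth c" "smooth d"
  shows "conn \<Phi> (2, 0) (frame_field a b c d) =
      frame_field (\<lambda>p. D1 a p - c p + 2 * d p) (D1 b) (\<lambda>p. D1 c p + a p) (\<lambda>p. D1 d p - a p)" (is ?A)
    and "conn \<Phi> (0, 2) (frame_field a b c d) =
      frame_field (D2 a) (\<lambda>p. D2 b p - c p - 2 * d p) (\<lambda>p. D2 c p + b p) (\<lambda>p. D2 d p + b p)" (is ?B)
proof -
  \<comment> \<open>The only contribution outside the tangent space of the sphere comes from D1 X1 =
    - 2 n1 = - \<Phi> + \<eta> - N; the projection in \<open>conn\<close> deletes its
    \<Phi>-part.\<close>
  have 1: "D1 (frame_field a b c d) p =
     frame_field (\<lambda>p. D1 a p - c p + 2 * d p) (D1 b) (\<lambda>p. D1 c p + a p) (\<lambda>p. D1 d p - a p) p - a p *\<^sub>R \<Phi> p" for p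
    by (simp add: frame_field_def[abs_def] dir_deriv_scaleR n_eq algebra_simps)
  have 2: "D2 (frame_field a b c d) p =
     frame_field (D2 a) (\<lambda>p. D2 b p - c p - 2 * d p) (\<lambda>p. D2 c p + b p) (\<lambda>p. D2 d p + b p) p - b p *\<^sub>R \<Phi> p" for p
    by (simp add: frame_field_def[abs_def] dir_deriv_scaleR n_eq algebra_simps)
  show ?A ?B
    unfolding conn_def fun_eq_iff 1 2 by (simp_all add: inner_diff_left)
qed

definition lap :: "(torus \<Rightarrow> real) \<Rightarrow> torus \<Rightarrow> real" where
  "lap u p = - (D1 (D1 u) p + D2 (D2 u) p)"

lemma smooth_lap [simp]: "smooth u \<Longrightarrow> smooth (lap u)"
  by (simp add: lap_def[abs_def])

text \<open>The four components of the rough Laplacian. The arguments record the coupling: the two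
  tangential components do not see each other here, nor do the two normal ones.\<close>

definition LA where "LA a c d = (\<lambda>p. lap a p + 3 * a p + 2 * D1 c p - 4 * D1 d p)"
definition LB where "LB b c d = (\<lambda>p. lap b p + 3 * b p + 2 * D2 c p + 4 * D2 d p)"
definition LC where "LC a b c = (\<lambda>p. lap c p + 2 * c p - 2 * D1 a p - 2 * D2 b p)"
definition LD where "LD a b d = (\<lambda>p. lap d p + 4 * d p + 2 * D1 a p - 2 * D2 b p)"

lemma smooth_L [simp]:
  "smooth a \<Longrightarrow> smooth c \<Longrightarrow> smooth d \<Longrightarrow> smooth (LA a c d)"
  "smooth b \<Longrightarrow> smooth c \<Longrightarrow> smooth d \<Longrightarrow> smooth (LB b c d)"
  "smooth a \<Longrightarrow> smooth b \<Longrightarrow> smooth c \<Longrightarrow> smooth (LC a b c)"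
  "smooth a \<Longrightarrow> smooth b \<Longrightarrow> smooth d \<Longrightarrow> smooth (LD a b d)"
  by (simp_all add: LA_def LB_def LC_def LD_def)

lemma frame_field_add: "frame_field a b c d p + frame_field a' b' c' d' p =
    frame_field (\<lambda>p. a p + a' p) (\<lambda>p. b p + b' p) (\<lambda>p. c p + c' p) (\<lambda>p. d p + d' p) p"
  and frame_field_scaleR: "r *\<^sub>R frame_field a b c d p = frame_field (\<lambda>p. r * a p) (\<lambda>p. r * b p) (\<lambda>p. r * c p) (\<lambda>p. r * d p) p"
  by (simp_all add: frame_field_def algebra_simps)

lemma rough_laplacian_frame_field:
  assumes [simp]: "smooth a" "smooth b" "smooth c" "smooth d"
  shows "rough_laplacian \<Phi> (frame_field a b c d) = frame_field (LA a c d) (LB b c d) (LC a b c) (LD a b d)"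
proof
  fix p
  show "rough_laplacian \<Phi> (frame_field a b c d) p = frame_field (LA a c d) (LB b c d) (LC a b c) (LD a b d) p"
    by (simp add: rough_laplacian_def frame_def conn_frame_field)
       (simp add: frame_field_def LA_def LB_def LC_def LD_def lap_def vec_eq_iff algebra_simps)
qed

lemma tension_\<Phi>: "tension \<Phi> = frame_field (\<lambda>p. 0) (\<lambda>p. 0) (\<lambda>p. 2) (\<lambda>p. 0)"
proof -
  have "X1 = frame_field (\<lambda>p. 1) (\<lambda>p. 0) (\<lambda>p. 0) (\<lambda>p. 0)" "X2 = frame_field (\<lambda>p. 0) (\<lambda>p. 1) (\<lambda>p. 0) (\<lambda>p. 0)"
    by (simp_all add: frame_field_def fun_eq_iff)
  then have "conn \<Phi> (2, 0) X1 p + conn \<Phi> (0, 2) X2 p = 2 *\<^sub>R \<eta> p" for p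
    using conn_frame_field[of "\<lambda>p. 1" "\<lambda>p. 0" "\<lambda>p. 0" "\<lambda>p. 0"]
      conn_frame_field[of "\<lambda>p. 0" "\<lambda>p. 1" "\<lambda>p. 0" "\<lambda>p. 0"]
    by (simp add: frame_field_def vec_eq_iff)
  then show ?thesis
    by (simp add: tension_def fun_eq_iff frame_def) (simp add: frame_field_def)
qed

text \<open>The components of \<open>I2\<close> after inserting |d\<Phi>|^2 = 2 and \<tau> = 2
  \<eta>. The scalar multiples of V have coefficients - 8 from the derivative of \<tau>, 4 from
  |\<tau>|^2 and 4 from |d\<Phi>|^4, and cancel.\<close>

definition RA where "RA a b c d = (\<lambda>p. LA (LA a c d) (LC a b c) (LD a b d) p
   - 3 * LA a c d p + lap a p - 4 * D1 c p)"
definition RB where "RB a b c d = (\<lambda>p. LB (LB b c d) (LC a b c) (LD a b d) p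
   - 3 * LB b c d p + lap b p - 4 * D2 c p)"
definition RC where "RC a b c d = (\<lambda>p. LC (LA a c d) (LB b c d) (LC a b c) p
   - 4 * LC a b c p + 2 * D1 a p + 2 * D2 b p - 12 * c p)"
definition RD where "RD a b c d = (\<lambda>p. LD (LA a c d) (LB b c d) (LD a b d) p
   - 4 * LD a b d p + 2 * D1 a p - 2 * D2 b p)"

lemma I2_frame_field:
  assumes [simp]: "smooth a" "smooth b" "smooth c" "smooth d"
  shows "I2 \<Phi> (frame_field a b c d) p = frame_field (RA a b c d) (RB a b c d) (RC a b c d) (RD a b c d) p"
proof -
  have norm: "norm_d_sq \<Phi> q = 2" for q
    by (simp add: norm_d_sq_def frame_def)
  have T: "(\<lambda>q. (\<Sum>e\<in>frame. (frame_field a b c d q \<bullet> dir_deriv e \<Phi> q) *\<^sub>R dir_deriv e \<Phi> q) - 2 *\<^sub>R frame_field a b c d q) =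
     frame_field (\<lambda>p. - a p) (\<lambda>p. - b p) (\<lambda>p. - 2 * c p) (\<lambda>p. - 2 * d p)"
    by (simp add: frame_def fun_eq_iff) (simp add: frame_field_def vec_eq_iff algebra_simps)
  show ?thesis
    unfolding I2_def Let_def norm T
    by (simp add: rough_laplacian_frame_field tension_\<Phi> frame_def conn_frame_field)
       \<comment> \<open>The definitions are instantiated so that the outer operators of the squared
         Laplacian stay folded and match on both sides.\<close>
       (simp add: LA_def[of "\<lambda>p. - a p"] LB_def[of "\<lambda>p. - b p"] LC_def[of "\<lambda>p. - a p"]
         LD_def[of "\<lambda>p. - a p"] lap_def[of "\<lambda>p. _ * _ p"] lap_def[of "\<lambda>p. - _ p"],
        simp add: frame_field_def LA_def[of a] LB_def[of b] LC_def[of a] LD_def[of a]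
          lap_def[of a] lap_def[of b] lap_def[of c] lap_def[of d] RA_def RB_def RC_def RD_def vec_eq_iff algebra_simps)
qed

section \<open>The kernel in frame coordinates\<close>

text \<open>\<open>X1\<close>, \<open>X2\<close>, \<open>\<eta>\<close>, \<open>N\<close> and \<Phi>
  form an orthogonal basis of the ambient space, so the remainder w, orthogonal to all five,
  vanishes. This is checked by passing through \<open>n1\<close> and \<open>n2\<close> to the
  standard basis.\<close>

lemma section_eq_frame_field:
  assumes "V p \<bullet> \<Phi> p = 0"
  shows "V p = frame_field (\<lambda>p. V p \<bullet> X1 p) (\<lambda>p. V p \<bullet> X2 p) (\<lambda>p. V p \<bullet> \<eta> p) (\<lambda>p. V p \<bullet> N p / 2) p"
    (is "_ = ?W")
proof -
  define w where "w = V p - ?W"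
  have w: "w \<bullet> X1 p = 0" "w \<bullet> X2 p = 0" "w \<bullet> \<eta> p = 0" "w \<bullet> N p = 0" "w \<bullet> \<Phi> p = 0"
    using assms by (simp_all add: w_def inner_diff_left)
  then have n: "w \<bullet> n1 p = 0" "w \<bullet> n2 p = 0"
    unfolding n_eq by (simp_all add: inner_add_right inner_diff_right)
  have "w \<bullet> E 5 = 0"
    using w(5) n by (simp add: \<Phi>_eq inner_add_right)
  moreover have "E 1 = cos (fst p) *\<^sub>R n1 p - sin (fst p) *\<^sub>R X1 p"
    "E 2 = sin (fst p) *\<^sub>R n1 p + cos (fst p) *\<^sub>R X1 p"
    "E 3 = cos (snd p) *\<^sub>R n2 p - sin (snd p) *\<^sub>R X2 p"
    "E 4 = sin (snd p) *\<^sub>R n2 p + cos (snd p) *\<^sub>R X2 p"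
    by (simp_all add: n1_def n2_def X1_def X2_def scaleR_add_right scaleR_diff_right
        flip: power2_eq_square scaleR_add_left)
      (simp_all add: algebra_simps flip: power2_eq_square scaleR_add_left)
  then have "w \<bullet> E 1 = 0" "w \<bullet> E 2 = 0" "w \<bullet> E 3 = 0" "w \<bullet> E 4 = 0"
    by (simp_all add: inner_add_right inner_diff_right w n)
  ultimately have "w $ i = 0" for i
    using exhaust_5[of i] by (auto simp: E_def inner_axis)
  then show ?thesis by (simp add: w_def vec_eq_iff)
qed

lemma frame_field_eq_iff:
  "frame_field a b c d p = frame_field a' b' c' d' p \<longleftrightarrow> a p = a' p \<and> b p = b' p \<and> c p = c' p \<and> d p = d' p"
proof (intro iffI)
  assume *: "frame_field a b c d p = frame_field a' b' c' d' p"
  show "a p = a' p \<and> b p = b' p \<and> c p = c' p \<and> d p = d' p"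
    using arg_cong[OF *, of "\<lambda>v. v \<bullet> X1 p"] arg_cong[OF *, of "\<lambda>v. v \<bullet> X2 p"]
      arg_cong[OF *, of "\<lambda>v. v \<bullet> \<eta> p"] arg_cong[OF *, of "\<lambda>v. v \<bullet> N p"] by simp
qed (simp add: frame_field_def)

lemma doubly_periodic_frame [simp]:
  "doubly_periodic X1" "doubly_periodic X2" "doubly_periodic \<eta>" "doubly_periodic N"
  by (simp_all add: doubly_periodic_def X1_def X2_def \<eta>_def N_def n1_def n2_def)

definition smooth_periodic :: "(torus \<Rightarrow> real) set" where
  "smooth_periodic = {u. smooth u \<and> doubly_periodic u}"

lemma frame_field_in_sections_iff:
  "frame_field a b c d \<in> sections \<Phi> \<longleftrightarrow> a \<in> smooth_periodic \<and> b \<in> smooth_periodic \<and> c \<in> smooth_periodic \<and> d \<in> smooth_periodic" (is "?l = ?r")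
proof
  assume l: ?l
  then have s: "smooth (frame_field a b c d)" "doubly_periodic (frame_field a b c d)"
    by (auto simp: sections_def)
  have e: "a = (\<lambda>p. frame_field a b c d p \<bullet> X1 p)" "b = (\<lambda>p. frame_field a b c d p \<bullet> X2 p)"
    "c = (\<lambda>p. frame_field a b c d p \<bullet> \<eta> p)" "d = (\<lambda>p. (1/2) * (frame_field a b c d p \<bullet> N p))"
    by simp_all
  have "smooth (\<lambda>p. frame_field a b c d p \<bullet> X1 p)" "smooth (\<lambda>p. frame_field a b c d p \<bullet> X2 p)"
    "smooth (\<lambda>p. frame_field a b c d p \<bullet> \<eta> p)" "smooth (\<lambda>p. (1/2) * (frame_field a b c d p \<bullet> N p))"
    by (intro smooth_mult smooth_inner smooth_const smooth_frame s)+
  moreover have "doubly_periodic (\<lambda>p. frame_field a b c d p \<bullet> X1 p)" "doubly_periodic (\<lambda>p. frame_field a b c d p \<bullet> X2 p)"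
    "doubly_periodic (\<lambda>p. frame_field a b c d p \<bullet> \<eta> p)" "doubly_periodic (\<lambda>p. (1/2) * (frame_field a b c d p \<bullet> N p))"
    using s(2) doubly_periodic_frame unfolding doubly_periodic_def by metis+
  ultimately show ?r unfolding smooth_periodic_def by simp
next
  assume ?r
  then show ?l
    by (simp add: smooth_periodic_def sections_def)
       (simp add: doubly_periodic_frame[unfolded doubly_periodic_def] doubly_periodic_def frame_field_def)
qed

text \<open>The frame is pointwise independent, so membership in the kernel becomes four scalar
  differential equations on doubly periodic functions.\<close>

lemma Ker_I2_frame_field:
  "frame_field a b c d \<in> Ker_I2 \<Phi> \<longleftrightarrow> a \<in> smooth_periodic \<and> b \<in> smooth_periodic \<and> c \<in> smooth_periodic \<and> d \<in> smooth_periodic \<and>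
    (\<forall>p. RA a b c d p = 0 \<and> RB a b c d p = 0 \<and> RC a b c d p = 0 \<and> RD a b c d p = 0)"
proof -
  have "frame_field a b c d p = 0 \<longleftrightarrow> a p = 0 \<and> b p = 0 \<and> c p = 0 \<and> d p = 0" for a b c d p
    using frame_field_eq_iff[of a b c d p "\<lambda>p. 0" "\<lambda>p. 0" "\<lambda>p. 0" "\<lambda>p. 0"] by (simp add: frame_field_def)
  then show ?thesis
    by (auto simp: Ker_I2_def frame_field_in_sections_iff I2_frame_field smooth_periodic_def)
qed

lemma Ker_I2_cases:
  assumes "V \<in> Ker_I2 \<Phi>"
  obtains a b c d where "V = frame_field a b c d"
proof -
  have "V = frame_field (\<lambda>p. V p \<bullet> X1 p) (\<lambda>p. V p \<bullet> X2 p) (\<lambda>p. V p \<bullet> \<eta> p) (\<lambda>p. V p \<bullet> N p / 2)"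
    using assms section_eq_frame_field by (auto simp: Ker_I2_def sections_def)
  with that show thesis .
qed

lemma smooth_periodic_closed [simp]:
  "u \<in> smooth_periodic \<Longrightarrow> v \<in> smooth_periodic \<Longrightarrow> (\<lambda>p. u p + v p) \<in> smooth_periodic"
  "u \<in> smooth_periodic \<Longrightarrow> (\<lambda>p. - u p) \<in> smooth_periodic" "u \<in> smooth_periodic \<Longrightarrow> (\<lambda>p. r * u p) \<in> smooth_periodic" "(\<lambda>p. r) \<in> smooth_periodic"
  by (auto simp: smooth_periodic_def doubly_periodic_def)

lemma lap_linear:
  "smooth u \<Longrightarrow> smooth v \<Longrightarrow> lap (\<lambda>p. u p + v p) = (\<lambda>p. lap u p + lap v p)"
  "smooth u \<Longrightarrow> lap (\<lambda>p. r * u p) = (\<lambda>p. r * lap u p)"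
  by (auto simp: lap_def algebra_simps)

lemma L_add:
  assumes "smooth a" "smooth b" "smooth c" "smooth d" "smooth a'" "smooth b'" "smooth c'" "smooth d'"
  shows "LA (\<lambda>p. a p + a' p) (\<lambda>p. c p + c' p) (\<lambda>p. d p + d' p) = (\<lambda>p. LA a c d p + LA a' c' d' p)"
    "LB (\<lambda>p. b p + b' p) (\<lambda>p. c p + c' p) (\<lambda>p. d p + d' p) = (\<lambda>p. LB b c d p + LB b' c' d' p)"
    "LC (\<lambda>p. a p + a' p) (\<lambda>p. b p + b' p) (\<lambda>p. c p + c' p) = (\<lambda>p. LC a b c p + LC a' b' c' p)"
    "LD (\<lambda>p. a p + a' p) (\<lambda>p. b p + b' p) (\<lambda>p. d p + d' p) = (\<lambda>p. LD a b d p + LD a' b' d' p)"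
  using assms by (simp_all add: LA_def LB_def LC_def LD_def lap_linear algebra_simps)

lemma L_cmult:
  assumes "smooth a" "smooth b" "smooth c" "smooth d"
  shows "LA (\<lambda>p. r * a p) (\<lambda>p. r * c p) (\<lambda>p. r * d p) = (\<lambda>p. r * LA a c d p)"
    "LB (\<lambda>p. r * b p) (\<lambda>p. r * c p) (\<lambda>p. r * d p) = (\<lambda>p. r * LB b c d p)"
    "LC (\<lambda>p. r * a p) (\<lambda>p. r * b p) (\<lambda>p. r * c p) = (\<lambda>p. r * LC a b c p)"
    "LD (\<lambda>p. r * a p) (\<lambda>p. r * b p) (\<lambda>p. r * d p) = (\<lambda>p. r * LD a b d p)"
  using assms by (simp_all add: LA_def LB_def LC_def LD_def lap_linear algebra_simps)

lemma subspace_Ker_I2: "subspace (Ker_I2 \<Phi>)"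
proof (rule subspaceI)
  have "frame_field (\<lambda>p. 0) (\<lambda>p. 0) (\<lambda>p. 0) (\<lambda>p. 0) \<in> Ker_I2 \<Phi>"
    by (simp add: Ker_I2_frame_field RA_def RB_def RC_def RD_def LA_def LB_def LC_def LD_def lap_def)
  moreover have "frame_field (\<lambda>p. 0) (\<lambda>p. 0) (\<lambda>p. 0) (\<lambda>p. 0) = 0"
    by (auto simp: frame_field_def)
  ultimately show "0 \<in> Ker_I2 \<Phi>" by simp
next
  fix V W assume VW: "V \<in> Ker_I2 \<Phi>" "W \<in> Ker_I2 \<Phi>"
  then obtain a b c d a' b' c' d' where eq: "V = frame_field a b c d" "W = frame_field a' b' c' d'"
    by (metis Ker_I2_cases)
  have sum: "V + W = frame_field (\<lambda>p. a p + a' p) (\<lambda>p. b p + b' p) (\<lambda>p. c p + c' p) (\<lambda>p. d p + d' p)"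
    unfolding eq by (rule ext) (simp add: frame_field_add)
  have "smooth a" "smooth b" "smooth c" "smooth d" "smooth a'" "smooth b'" "smooth c'" "smooth d'"
    using VW by (auto simp: eq Ker_I2_frame_field smooth_periodic_def)
  then have "RA (\<lambda>p. a p + a' p) (\<lambda>p. b p + b' p) (\<lambda>p. c p + c' p) (\<lambda>p. d p + d' p) p
      = RA a b c d p + RA a' b' c' d' p"
    "RB (\<lambda>p. a p + a' p) (\<lambda>p. b p + b' p) (\<lambda>p. c p + c' p) (\<lambda>p. d p + d' p) p
      = RB a b c d p + RB a' b' c' d' p"
    "RC (\<lambda>p. a p + a' p) (\<lambda>p. b p + b' p) (\<lambda>p. c p + c' p) (\<lambda>p. d p + d' p) p
      = RC a b c d p + RC a' b' c' d' p"
    "RD (\<lambda>p. a p + a' p) (\<lambda>p. b p + b' p) (\<lambda>p. c p + c' p) (\<lambda>p. d p + d' p) p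
      = RD a b c d p + RD a' b' c' d' p" for p
    by (simp_all add: RA_def RB_def RC_def RD_def L_add lap_linear)
  then show "V + W \<in> Ker_I2 \<Phi>" using VW unfolding sum Ker_I2_frame_field unfolding eq Ker_I2_frame_field by simp
next
  fix V r assume V: "V \<in> Ker_I2 \<Phi>"
  then obtain a b c d where eq: "V = frame_field a b c d"
    by (metis Ker_I2_cases)
  have rV: "r *\<^sub>R V = frame_field (\<lambda>p. r * a p) (\<lambda>p. r * b p) (\<lambda>p. r * c p) (\<lambda>p. r * d p)"
    unfolding eq by (rule ext) (simp add: frame_field_scaleR scaleR_fun_def)
  have "smooth a" "smooth b" "smooth c" "smooth d"
    using V by (auto simp: eq Ker_I2_frame_field smooth_periodic_def)
  then have "RA (\<lambda>p. r * a p) (\<lambda>p. r * b p) (\<lambda>p. r * c p) (\<lambda>p. r * d p) p = r * RA a b c d p"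
    "RB (\<lambda>p. r * a p) (\<lambda>p. r * b p) (\<lambda>p. r * c p) (\<lambda>p. r * d p) p = r * RB a b c d p"
    "RC (\<lambda>p. r * a p) (\<lambda>p. r * b p) (\<lambda>p. r * c p) (\<lambda>p. r * d p) p = r * RC a b c d p"
    "RD (\<lambda>p. r * a p) (\<lambda>p. r * b p) (\<lambda>p. r * c p) (\<lambda>p. r * d p) p = r * RD a b c d p" for p
    by (simp_all add: RA_def RB_def RC_def RD_def L_cmult lap_linear algebra_simps)
  then show "r *\<^sub>R V \<in> Ker_I2 \<Phi>" using V unfolding rV Ker_I2_frame_field unfolding eq Ker_I2_frame_field by simp
qed

section \<open>Kernel elements of frequency at most one\<close>

lemma tensor_neg [simp]:
  "tensor (\<lambda>x. - f x) g = (\<lambda>p. - tensor f g p)" "tensor f (\<lambda>x. - g x) = (\<lambda>p. - tensor f g p)"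
  "tensor (\<lambda>x. 0) g = (\<lambda>p. 0)" "tensor f (\<lambda>x. 0) = (\<lambda>p. 0)"
  "tensor (\<lambda>x. r * f x) g = (\<lambda>p. r * tensor f g p)" "tensor f (\<lambda>x. r * g x) = (\<lambda>p. r * tensor f g p)"
  by (auto simp: tensor_def)

lemma tensor_smooth_periodic:
  assumes "trig_pair m f f'" "trig_pair n g g'"
  shows "tensor f g \<in> smooth_periodic"
  using assms smooth_tensor[OF assms]
  by (auto simp: smooth_periodic_def doubly_periodic_def tensor_def trig_pair_def)

text \<open>With f and g ranging over cos and sin, this is the common form of the four rotations
  that mix a coordinate of one circle with a coordinate of the other; only f'' = - f and g'' = - g
  matter.\<close>

lemma Ker_I2_mode11:
  assumes "trig_pair 1 f f'" "trig_pair 1 g g'"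
  shows "frame_field (\<lambda>p. - tensor f' g p) (\<lambda>p. tensor f g' p) (\<lambda>p. 0)
    (\<lambda>p. - tensor f g p) \<in> Ker_I2 \<Phi>"
proof -
  have t: "trig_pair 1 f' (\<lambda>x. - f x)" "trig_pair 1 g' (\<lambda>x. - g x)"
    using assms[THEN trig_pair_deriv] by simp_all
  note [simp] = D_tensor[OF assms] D_tensor[OF t(1) assms(2)] D_tensor[OF assms(1) t(2)] D_tensor[OF t]
    smooth_tensor[OF assms] smooth_tensor[OF t(1) assms(2)] smooth_tensor[OF assms(1) t(2)] smooth_tensor[OF t]
    tensor_smooth_periodic[OF assms] tensor_smooth_periodic[OF t(1) assms(2)] tensor_smooth_periodic[OF assms(1) t(2)]
  show ?thesis
    unfolding Ker_I2_frame_field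
    by (intro conjI allI; simp?)
      (simp_all add: RA_def RB_def RC_def RD_def LA_def LB_def LC_def LD_def lap_def)
qed

text \<open>The form of the two rotations mixing the plane of the first circle with the fifth
  coordinate.\<close>

lemma Ker_I2_mode10:
  assumes "trig_pair 1 f f'"
  shows "frame_field (\<lambda>p. - 2 * tensor f' (\<lambda>x. 1) p) (\<lambda>p. 0) (\<lambda>p. 2 * tensor f (\<lambda>x. 1) p)
    (\<lambda>p. - tensor f (\<lambda>x. 1) p) \<in> Ker_I2 \<Phi>"
proof -
  have t: "trig_pair 1 f' (\<lambda>x. - f x)"
    using assms[THEN trig_pair_deriv] by simp
  note c = trig_pair_const[of 1]
  note [simp] = D_tensor[OF assms c] D_tensor[OF t c]
    smooth_tensor[OF assms c] smooth_tensor[OF t c] tensor_smooth_periodic[OF assms c] tensor_smooth_periodic[OF t c]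
  show ?thesis
    unfolding Ker_I2_frame_field
    by (intro conjI allI; simp?)
      (simp_all add: RA_def RB_def RC_def RD_def LA_def LB_def LC_def LD_def lap_def)
qed

text \<open>The counterpart for the second circle. Exchanging the circles sends \<open>N\<close> to
  its negative, which explains the changed sign of the last component.\<close>

lemma Ker_I2_mode01:
  assumes "trig_pair 1 g g'"
  shows "frame_field (\<lambda>p. 0) (\<lambda>p. - 2 * tensor (\<lambda>x. 1) g' p) (\<lambda>p. 2 * tensor (\<lambda>x. 1) g p)
    (\<lambda>p. tensor (\<lambda>x. 1) g p) \<in> Ker_I2 \<Phi>"
proof -
  have t: "trig_pair 1 g' (\<lambda>x. - g x)"
    using assms[THEN trig_pair_deriv] by simp
  note c = trig_pair_const[of 1]
  note [simp] = D_tensor[OF c assms] D_tensor[OF c t]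
    smooth_tensor[OF c assms] smooth_tensor[OF c t] tensor_smooth_periodic[OF c assms] tensor_smooth_periodic[OF c t]
  show ?thesis
    unfolding Ker_I2_frame_field
    by (intro conjI allI; simp?)
      (simp_all add: RA_def RB_def RC_def RD_def LA_def LB_def LC_def LD_def lap_def)
qed

text \<open>Constant multiples of \<open>X1\<close> and \<open>X2\<close> are the rotations of the
  two circles, those of \<open>N\<close> give \<open>V\<^sub>\<nu>\<close>. The third component is
  zero because \<open>I2\<close> multiplies constant multiples of \<open>\<eta>\<close> by -
  16.\<close>

lemma Ker_I2_mode00: "frame_field (\<lambda>p. r) (\<lambda>p. s) (\<lambda>p. 0) (\<lambda>p. t) \<in> Ker_I2 \<Phi>"
  by (simp add: Ker_I2_frame_field RA_def RB_def RC_def RD_def LA_def LB_def LC_def LD_def lap_def)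

section \<open>The eleven fields in the adapted frame\<close>

abbreviation "killing i \<equiv> Z i \<circ> \<Phi>"

lemma \<Phi>_nth: "\<Phi> p $ 1 = cos (fst p) / 2" "\<Phi> p $ 2 = sin (fst p) / 2" "\<Phi> p $ 3 = cos (snd p) / 2"
  "\<Phi> p $ 4 = sin (snd p) / 2" "\<Phi> p $ 5 = 1 / sqrt 2"
  by (cases p; simp add: \<Phi>_def)+

lemma Z_simps [simp]:
  "Z 1 y = vector [- y$2, y$1, 0, 0, 0]" "Z 2 y = vector [0, 0, - y$4, y$3, 0]"
  "Z 3 y = vector [- y$4, 0, 0, y$1, 0]" "Z 4 y = vector [0, - y$3, y$2, 0, 0]"
  "Z 5 y = vector [- y$3, 0, y$1, 0, 0]" "Z 6 y = vector [0, - y$4, 0, y$2, 0]"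
  "Z 7 y = vector [0, - y$5, 0, 0, y$2]" "Z 8 y = vector [- y$5, 0, 0, 0, y$1]"
  "Z 9 y = vector [0, 0, 0, - y$5, y$4]" "Z 10 y = vector [0, 0, - y$5, 0, y$3]"
  "Z (Suc 0) y = vector [- y$2, y$1, 0, 0, 0]"
  by (simp_all add: Z_def)

lemma frame_nth [simp]:
  "n1 p $ 1 = cos (fst p)" "n1 p $ 2 = sin (fst p)" "n1 p $ 3 = 0" "n1 p $ 4 = 0" "n1 p $ 5 = 0"
  "X1 p $ 1 = - sin (fst p)" "X1 p $ 2 = cos (fst p)" "X1 p $ 3 = 0" "X1 p $ 4 = 0" "X1 p $ 5 = 0"
  "n2 p $ 3 = cos (snd p)" "n2 p $ 4 = sin (snd p)" "n2 p $ 1 = 0" "n2 p $ 2 = 0" "n2 p $ 5 = 0"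
  "X2 p $ 3 = - sin (snd p)" "X2 p $ 4 = cos (snd p)" "X2 p $ 1 = 0" "X2 p $ 2 = 0" "X2 p $ 5 = 0"
  by (simp_all add: n1_def X1_def n2_def X2_def E_def axis_def)

lemma \<eta>_nth:
  "\<eta> p $ 1 = - cos (fst p) / 2" "\<eta> p $ 2 = - sin (fst p) / 2" "\<eta> p $ 3 = - cos (snd p) / 2"
  "\<eta> p $ 4 = - sin (snd p) / 2" "\<eta> p $ 5 = 1 / sqrt 2"
  by (simp_all add: \<eta>_def E_def axis_def)

lemma V\<^sub>\<nu>_eq: "V\<^sub>\<nu> = frame_field (\<lambda>p. 0) (\<lambda>p. 0) (\<lambda>p. 0) (\<lambda>p. 1 / sqrt 2)"
  by (rule ext) (simp add: V\<^sub>\<nu>_def vec_eq_iff forall_5 frame_field_def N_def split_beta)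

lemma sin_times_sin: "sin x * sin x = 1 - cos x * cos (x::real)"
  by (metis cos_squared_eq power2_eq_square add_diff_cancel_right' sin_squared_eq)

lemma sin_times_sin_times: "sin x * (sin x * y) = y - cos x * (cos x * (y::real))"
  using sin_times_sin[of x] by (metis mult.assoc left_diff_distrib mult_1)

text \<open>The right-hand sides keep the literal shape of the mode lemmas, with
  \<open>\<lambda>x. - sin x\<close> and \<open>\<lambda>x. 1\<close> unsimplified, so that kernel
  membership and later the pairings follow by unification.\<close>

lemma killing_eq:
  "killing 1 = frame_field (\<lambda>p. 1 / 2) (\<lambda>p. 0) (\<lambda>p. 0) (\<lambda>p. 0)"
  "killing 2 = frame_field (\<lambda>p. 0) (\<lambda>p. 1 / 2) (\<lambda>p. 0) (\<lambda>p. 0)"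
  "killing 3 = (1 / 2) *\<^sub>R frame_field (\<lambda>p. - tensor (\<lambda>x. - sin x) sin p) (\<lambda>p. tensor cos cos p) (\<lambda>p. 0)
    (\<lambda>p. - tensor cos sin p)"
  "killing 4 = (1 / 2) *\<^sub>R frame_field (\<lambda>p. - tensor cos cos p) (\<lambda>p. tensor sin (\<lambda>x. - sin x) p) (\<lambda>p. 0)
    (\<lambda>p. - tensor sin cos p)"
  "killing 5 = (1 / 2) *\<^sub>R frame_field (\<lambda>p. - tensor (\<lambda>x. - sin x) cos p) (\<lambda>p. tensor cos (\<lambda>x. - sin x) p) (\<lambda>p. 0)
    (\<lambda>p. - tensor cos cos p)"
  "killing 6 = (1 / 2) *\<^sub>R frame_field (\<lambda>p. - tensor cos sin p) (\<lambda>p. tensor sin cos p) (\<lambda>p. 0)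
    (\<lambda>p. - tensor sin sin p)"
  "killing 7 = (1 / (2 * sqrt 2)) *\<^sub>R frame_field (\<lambda>p. - 2 * tensor cos (\<lambda>x. 1) p) (\<lambda>p. 0) (\<lambda>p. 2 * tensor sin (\<lambda>x. 1) p)
    (\<lambda>p. - tensor sin (\<lambda>x. 1) p)"
  "killing 8 = (1 / (2 * sqrt 2)) *\<^sub>R frame_field (\<lambda>p. - 2 * tensor (\<lambda>x. - sin x) (\<lambda>x. 1) p) (\<lambda>p. 0) (\<lambda>p. 2 * tensor cos (\<lambda>x. 1) p)
    (\<lambda>p. - tensor cos (\<lambda>x. 1) p)"
  "killing 9 = (1 / (2 * sqrt 2)) *\<^sub>R frame_field (\<lambda>p. 0) (\<lambda>p. - 2 * tensor (\<lambda>x. 1) cos p) (\<lambda>p. 2 * tensor (\<lambda>x. 1) sin p)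
    (\<lambda>p. tensor (\<lambda>x. 1) sin p)"
  "killing 10 = (1 / (2 * sqrt 2)) *\<^sub>R frame_field (\<lambda>p. 0) (\<lambda>p. - 2 * tensor (\<lambda>x. 1) (\<lambda>x. - sin x) p) (\<lambda>p. 2 * tensor (\<lambda>x. 1) cos p)
    (\<lambda>p. tensor (\<lambda>x. 1) cos p)"
  by (rule ext, simp add: vec_eq_iff forall_5 \<Phi>_nth frame_field_def N_def \<eta>_nth tensor_def scaleR_fun_def
      field_simps sin_times_sin sin_times_sin_times; (simp add: algebra_simps sin_times_sin sin_times_sin_times)?)+

lemma killing_in_Ker: "i \<in> {1..10} \<Longrightarrow> killing i \<in> Ker_I2 \<Phi>"
proof -
  assume "i \<in> {1..10}"
  then have "i \<in> {1,2,3,4,5,6,7,8,9,10}" by simp presburger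
  then show ?thesis
    by (elim insertE emptyE; hypsubst)
      (simp_all only: killing_eq Ker_I2_mode00, (intro subspace_scale subspace_Ker_I2
        Ker_I2_mode11 Ker_I2_mode10 Ker_I2_mode01 trig_pair_simple)+)
qed

lemma V\<^sub>\<nu>_in_Ker: "V\<^sub>\<nu> \<in> Ker_I2 \<Phi>"
  by (simp add: V\<^sub>\<nu>_eq Ker_I2_mode00)

section \<open>Fourier coefficients on the torus\<close>

lemma smooth_periodic_mult [simp]: "u \<in> smooth_periodic \<Longrightarrow> v \<in> smooth_periodic \<Longrightarrow> (\<lambda>p. u p * v p) \<in> smooth_periodic"
  by (auto simp: smooth_periodic_def doubly_periodic_def)

lemma smooth_periodic_smooth: "u \<in> smooth_periodic \<Longrightarrow> smooth u"
  by (simp add: smooth_periodic_def)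

lemma smooth_periodic_diff [simp]: "u \<in> smooth_periodic \<Longrightarrow> v \<in> smooth_periodic \<Longrightarrow> (\<lambda>p. u p - v p) \<in> smooth_periodic"
  using smooth_periodic_closed(1)[of u "\<lambda>p. - v p"] by simp

lemma smooth_periodic_dir_deriv [simp]:
  assumes "u \<in> smooth_periodic" shows "dir_deriv X u \<in> smooth_periodic"
proof -
  have *: "dir_deriv X u (p + c) = dir_deriv X u p" if "\<And>p. u (p + c) = u p" for c p
  proof -
    have "(u has_derivative frechet_derivative u (at (p + c))) (at (p + c))"
      using assms by (intro smooth_has_derivative smooth_periodic_smooth)
    from has_derivative_compose[OF has_derivative_add_const[OF has_derivative_ident] this]
    have "(u has_derivative frechet_derivative u (at (p + c))) (at p)"
      by (simp only: that)
    then show ?thesis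
      by (simp only: dir_deriv_eqI) (simp only: dir_deriv_def)
  qed
  have u: "u (p + (2 * pi, 0)) = u p" "u (p + (0, 2 * pi)) = u p" for p
    using assms by (cases p; simp add: smooth_periodic_def doubly_periodic_def)+
  have "dir_deriv X u ((\<gamma>, \<theta>) + (2 * pi, 0)) = dir_deriv X u (\<gamma>, \<theta>)"
    "dir_deriv X u ((\<gamma>, \<theta>) + (0, 2 * pi)) = dir_deriv X u (\<gamma>, \<theta>)" for \<gamma> \<theta>
    by (rule * u)+
  then show ?thesis
    using assms by (simp add: smooth_periodic_def doubly_periodic_def)
qed

declare smooth_periodic_smooth [simp]

lemma smooth_periodic_L [simp]:
  "a \<in> smooth_periodic \<Longrightarrow> lap a \<in> smooth_periodic"
  "a \<in> smooth_periodic \<Longrightarrow> c \<in> smooth_periodic \<Longrightarrow> d \<in> smooth_periodic \<Longrightarrow> LA a c d \<in> smooth_periodic"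
  "b \<in> smooth_periodic \<Longrightarrow> c \<in> smooth_periodic \<Longrightarrow> d \<in> smooth_periodic \<Longrightarrow> LB b c d \<in> smooth_periodic"
  "a \<in> smooth_periodic \<Longrightarrow> b \<in> smooth_periodic \<Longrightarrow> c \<in> smooth_periodic \<Longrightarrow> LC a b c \<in> smooth_periodic"
  "a \<in> smooth_periodic \<Longrightarrow> b \<in> smooth_periodic \<Longrightarrow> d \<in> smooth_periodic \<Longrightarrow> LD a b d \<in> smooth_periodic"
  by (simp_all add: lap_def[abs_def] LA_def LB_def LC_def LD_def)

abbreviation period_cell :: "torus set" where "period_cell \<equiv> cbox (0, 0) (2 * pi, 2 * pi)"

lemma smooth_periodic_continuous: "u \<in> smooth_periodic \<Longrightarrow> continuous_on S u"
  using smooth_continuous continuous_on_subset smooth_periodic_smooth by blast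

lemma smooth_periodic_integrable [simp]: "u \<in> smooth_periodic \<Longrightarrow> u integrable_on period_cell"
  using smooth_periodic_continuous integrable_continuous by blast

text \<open>The fundamental theorem of calculus over one full period gives zero in the
  differentiated variable; Fubini does the rest.\<close>

lemma integral_D_smooth_periodic:
  assumes "u \<in> smooth_periodic"
  shows "integral period_cell (D1 u) = 0" "integral period_cell (D2 u) = 0"
proof -
  have cont: "continuous_on S (dir_deriv X u)" for S X
    using assms by (intro smooth_periodic_continuous) simp
  have der: "(u has_derivative (\<lambda>X. dir_deriv X u p)) (at p)" for p
    using smooth_has_derivative[of u] assms by (simp add: dir_deriv_def)
  have D: "dir_deriv (2, 0) u p = 2 * dir_deriv (1, 0) u p" "dir_deriv (0, 2) u p = 2 * dir_deriv (0, 1) u p" for p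
    using linear_scale[OF has_derivative_linear[OF der[of p]], of 2 "(1, 0)"]
      linear_scale[OF has_derivative_linear[OF der[of p]], of 2 "(0, 1)"] by simp_all
  have "integral {0..2*pi} (\<lambda>x. D1 u (x, y)) = 0" for y
  proof -
    have "((\<lambda>x. 2 * u (x, y)) has_vector_derivative D1 u (x, y)) (at x within {0..2*pi})" for x
    proof -
      have "((\<lambda>x. u (x, y)) has_derivative (\<lambda>h. dir_deriv (h, 0) u (x, y))) (at x)"
        by (rule has_derivative_compose[OF _ der, of "\<lambda>x. (x, y)" "\<lambda>h. (h, 0)"])
           (auto intro!: derivative_eq_intros)
      moreover have "(\<lambda>h. dir_deriv (h, 0) u (x, y)) = (*) (dir_deriv (1, 0) u (x, y))"
      proof
        show "dir_deriv (h, 0) u (x, y) = dir_deriv (1, 0) u (x, y) * h" for h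
          using linear_scale[OF has_derivative_linear[OF der], of h "(1, 0)"] by simp
      qed
      ultimately have "((\<lambda>x. u (x, y)) has_field_derivative dir_deriv (1, 0) u (x, y)) (at x)"
        by (simp add: has_field_derivative_def)
      then have "((\<lambda>x. 2 * u (x, y)) has_field_derivative D1 u (x, y)) (at x)"
        unfolding D by (rule DERIV_cmult)
      then show ?thesis
        using has_vector_derivative_at_within has_real_derivative_iff_has_vector_derivative by blast
    qed
    then have "((\<lambda>x. D1 u (x, y)) has_integral (2 * u (2 * pi, y) - 2 * u (0, y))) {0..2*pi}"
      by (intro fundamental_theorem_of_calculus) auto
    moreover have "u (0 + 2 * pi, y) = u (0, y)"
      using assms unfolding smooth_periodic_def doubly_periodic_def by blast
    ultimately show ?thesis by (simp add: integral_unique)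
  qed
  \<comment> \<open>The iterated integral has the second angle innermost, so \<open>D1\<close> needs
    the order of integration exchanged.\<close>
  moreover have "integral period_cell (D1 u) = integral {0..2*pi} (\<lambda>y. integral {0..2*pi} (\<lambda>x. D1 u (x, y)))"
    using integral_prod_continuous[OF cont, of 0 0 "2*pi" "2*pi" "(2, 0)"]
      integral_swap_continuous[of 0 0 "2*pi" "2*pi" "\<lambda>x y. D1 u (x, y)"] cont by simp
  ultimately show "integral period_cell (D1 u) = 0" by simp
  have "integral {0..2*pi} (\<lambda>y. D2 u (x, y)) = 0" for x
  proof -
    have "((\<lambda>y. 2 * u (x, y)) has_vector_derivative D2 u (x, y)) (at y within {0..2*pi})" for y
    proof -
      have "((\<lambda>y. u (x, y)) has_derivative (\<lambda>h. dir_deriv (0, h) u (x, y))) (at y)"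
        by (rule has_derivative_compose[OF _ der, of "\<lambda>y. (x, y)" "\<lambda>h. (0, h)"])
           (auto intro!: derivative_eq_intros)
      moreover have "(\<lambda>h. dir_deriv (0, h) u (x, y)) = (*) (dir_deriv (0, 1) u (x, y))"
      proof
        show "dir_deriv (0, h) u (x, y) = dir_deriv (0, 1) u (x, y) * h" for h
          using linear_scale[OF has_derivative_linear[OF der], of h "(0, 1)"] by simp
      qed
      ultimately have "((\<lambda>y. u (x, y)) has_field_derivative dir_deriv (0, 1) u (x, y)) (at y)"
        by (simp add: has_field_derivative_def)
      then have "((\<lambda>y. 2 * u (x, y)) has_field_derivative D2 u (x, y)) (at y)"
        unfolding D by (rule DERIV_cmult)
      then show ?thesis
        using has_vector_derivative_at_within has_real_derivative_iff_has_vector_derivative by blast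
    qed
    then have "((\<lambda>y. D2 u (x, y)) has_integral (2 * u (x, 2 * pi) - 2 * u (x, 0))) {0..2*pi}"
      by (intro fundamental_theorem_of_calculus) auto
    moreover have "u (x, 0 + 2 * pi) = u (x, 0)"
      using assms unfolding smooth_periodic_def doubly_periodic_def by blast
    ultimately show ?thesis by (simp add: integral_unique)
  qed
  then show "integral period_cell (D2 u) = 0"
    using integral_prod_continuous[OF cont, of 0 0 "2*pi" "2*pi" "(0, 2)"] by simp
qed

lemma dir_deriv_mult:
  fixes u v :: "torus \<Rightarrow> real"
  assumes "smooth u" "smooth v"
  shows "dir_deriv X (\<lambda>p. u p * v p) = (\<lambda>p. u p * dir_deriv X v p + dir_deriv X u p * v p)"
  using dir_deriv_scaleR[OF assms] by simp

definition fourier :: "(real \<Rightarrow> real) \<Rightarrow> (real \<Rightarrow> real) \<Rightarrow> (torus \<Rightarrow> real) \<Rightarrow> real" where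
  "fourier f g u = integral period_cell (\<lambda>p. u p * tensor f g p)"

lemma fourier_linear:
  assumes "tensor f g \<in> smooth_periodic"
  shows "u \<in> smooth_periodic \<Longrightarrow> v \<in> smooth_periodic \<Longrightarrow> fourier f g (\<lambda>p. u p + v p) = fourier f g u + fourier f g v"
    "u \<in> smooth_periodic \<Longrightarrow> v \<in> smooth_periodic \<Longrightarrow> fourier f g (\<lambda>p. u p - v p) = fourier f g u - fourier f g v"
    "fourier f g (\<lambda>p. - u p) = - fourier f g u"
    "fourier f g (\<lambda>p. r * u p) = r * fourier f g u"
  using assms by (simp_all add: fourier_def distrib_right left_diff_distrib integral_add integral_diff mult.assoc)

lemma fourier_test [simp]:
  "fourier (\<lambda>x. - f x) g u = - fourier f g u" "fourier f (\<lambda>x. - g x) u = - fourier f g u"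
  "fourier (\<lambda>x. r * f x) g u = r * fourier f g u" "fourier f (\<lambda>x. r * g x) u = r * fourier f g u"
  "fourier (\<lambda>x. 0) g u = 0" "fourier f (\<lambda>x. 0) u = 0"
  by (simp_all add: fourier_def mult.left_commute[of _ r])

text \<open>Integration by parts: the total derivative integrates to zero by periodicity. The 2 is
  the coordinate length of the frame vectors.\<close>

lemma fourier_D:
  assumes "trig_pair m f f'" "trig_pair n g g'" "u \<in> smooth_periodic"
  shows "fourier f g (D1 u) = - 2 * fourier f' g u" "fourier f g (D2 u) = - 2 * fourier f g' u"
proof -
  note t = tensor_smooth_periodic[OF assms(1,2)] tensor_smooth_periodic[OF trig_pair_deriv[OF assms(1)] assms(2)]
    tensor_smooth_periodic[OF assms(1) trig_pair_deriv[OF assms(2)]]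
  have "integral period_cell (\<lambda>p. D1 u p * tensor f g p) + 2 * fourier f' g u = integral period_cell (D1 (\<lambda>p. u p * tensor f g p))"
    using t assms by (simp add: dir_deriv_mult D_tensor[OF assms(1,2)] fourier_def integral_add mult.left_commute[of _ 2])
  then show "fourier f g (D1 u) = - 2 * fourier f' g u"
    using t assms by (simp add: integral_D_smooth_periodic fourier_def)
  have "integral period_cell (\<lambda>p. D2 u p * tensor f g p) + 2 * fourier f g' u = integral period_cell (D2 (\<lambda>p. u p * tensor f g p))"
    using t assms by (simp add: dir_deriv_mult D_tensor[OF assms(1,2)] fourier_def integral_add mult.left_commute[of _ 2])
  then show "fourier f g (D2 u) = - 2 * fourier f g' u"
    using t assms by (simp add: integral_D_smooth_periodic fourier_def)
qed

section \<open>Trigonometric polynomials and completeness\<close>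

definition wave :: "nat \<Rightarrow> real \<Rightarrow> real \<Rightarrow> real" where
  "wave m \<phi> x = cos (real m * x + \<phi>)"

lemma trig_pair_wave: "trig_pair m (wave m \<phi>) (\<lambda>x. real m * wave m (\<phi> + pi / 2) x)"
proof -
  have "wave m (\<phi> + pi / 2) x = - sin (real m * x + \<phi>)" for x
    using cos_add[of "real m * x + \<phi>" "pi / 2"] by (simp add: wave_def add.assoc)
  then show ?thesis
    using trig_pair_cos[of m \<phi>] by (simp add: wave_def[abs_def])
qed

text \<open>Allowing a phase leaves one product-to-sum formula where cos and sin would need four.
  The difference frequency may be negative while \<open>wave\<close> takes a natural number;
  evenness of cos then flips the sign of frequency and phase, hence the existential.\<close>

lemma wave_mult:
  "\<exists>j \<rho>. \<forall>x. wave m \<phi> x * wave k \<psi> x = 1 / 2 * wave (m + k) (\<phi> + \<psi>) x + 1 / 2 * wave j \<rho> x"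
proof -
  have *: "wave m \<phi> x * wave k \<psi> x = 1 / 2 * wave (m + k) (\<phi> + \<psi>) x
      + 1 / 2 * cos ((real m - real k) * x + (\<phi> - \<psi>))" for x
    using cos_times_cos[of "real m * x + \<phi>" "real k * x + \<psi>"]
    by (simp add: wave_def field_simps)
  show ?thesis
  proof (cases "k \<le> m")
    case True
    then have "cos ((real m - real k) * x + (\<phi> - \<psi>)) = wave (m - k) (\<phi> - \<psi>) x" for x
      by (simp add: wave_def of_nat_diff)
    then show ?thesis using * by metis
  next
    case False
    have "cos ((real m - real k) * x + (\<phi> - \<psi>)) = wave (k - m) (\<psi> - \<phi>) x" for x
      using False cos_minus[of "(real m - real k) * x + (\<phi> - \<psi>)"]
      by (simp add: wave_def of_nat_diff algebra_simps)
    then show ?thesis using * by metis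
  qed
qed

definition waves :: "(torus \<Rightarrow> real) set" where
  "waves = span {tensor (wave m \<phi>) (wave n \<psi>) | m n \<phi> \<psi>. True}"

lemma wave_in_waves: "tensor (wave m \<phi>) (wave n \<psi>) \<in> waves"
  unfolding waves_def by (intro span_base) blast

lemma waves_add: "s \<in> waves \<Longrightarrow> t \<in> waves \<Longrightarrow> (\<lambda>p. s p + t p) \<in> waves"
  unfolding waves_def using span_add by (fastforce simp: plus_fun_def)

lemma waves_cmult: "s \<in> waves \<Longrightarrow> (\<lambda>p. r * s p) \<in> waves"
  unfolding waves_def using span_scale[of s _ r] by (simp add: scaleR_fun_def)

lemma waves_induct [consumes 1, case_names wave zero add cmult]:
  assumes "h \<in> waves" "\<And>m n \<phi> \<psi>. P (tensor (wave m \<phi>) (wave n \<psi>))"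
    "P (\<lambda>p. 0)" "\<And>s t. P s \<Longrightarrow> P t \<Longrightarrow> P (\<lambda>p. s p + t p)" "\<And>r s. P s \<Longrightarrow> P (\<lambda>p. r * s p)"
  shows "P h"
  using assms(1) unfolding waves_def
proof (rule span_induct)
  show "subspace {x. P x}"
  proof (rule subspaceI)
    show "0 \<in> {x. P x}" using assms(3) by (simp add: zero_fun_def)
    show "s + t \<in> {x. P x}" if "s \<in> {x. P x}" "t \<in> {x. P x}" for s t
      using that assms(4) by (simp add: plus_fun_def)
    show "r *\<^sub>R s \<in> {x. P x}" if "s \<in> {x. P x}" for r s
      using that assms(5) by (simp add: scaleR_fun_def)
  qed
  show "x \<in> {tensor (wave m \<phi>) (wave n \<psi>) |m n \<phi> \<psi>. True} \<Longrightarrow> P x" for x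
    using assms(2) by blast
qed

lemma waves_mult:
  assumes "s \<in> waves" "t \<in> waves"
  shows "(\<lambda>p. s p * t p) \<in> waves"
  using assms(1)
proof (induction rule: waves_induct)
  case (wave m n \<phi> \<psi>)
  from assms(2) show ?case
  proof (induction rule: waves_induct)
    case (wave m' n' \<phi>' \<psi>')
    obtain j \<rho> where A: "\<And>x. wave m \<phi> x * wave m' \<phi>' x
        = 1 / 2 * wave (m + m') (\<phi> + \<phi>') x + 1 / 2 * wave j \<rho> x"
      using wave_mult by metis
    obtain i \<xi> where B: "\<And>x. wave n \<psi> x * wave n' \<psi>' x
        = 1 / 2 * wave (n + n') (\<psi> + \<psi>') x + 1 / 2 * wave i \<xi> x"
      using wave_mult by metis
    have "tensor (wave m \<phi>) (wave n \<psi>) p * tensor (wave m' \<phi>') (wave n' \<psi>') p =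
        1 / 4 * tensor (wave (m + m') (\<phi> + \<phi>')) (wave (n + n') (\<psi> + \<psi>')) p
        + 1 / 4 * tensor (wave (m + m') (\<phi> + \<phi>')) (wave i \<xi>) p
        + 1 / 4 * tensor (wave j \<rho>) (wave (n + n') (\<psi> + \<psi>')) p
        + 1 / 4 * tensor (wave j \<rho>) (wave i \<xi>) p" for p
    proof -
      have "tensor (wave m \<phi>) (wave n \<psi>) p * tensor (wave m' \<phi>') (wave n' \<psi>') p =
          (wave m \<phi> (fst p) * wave m' \<phi>' (fst p)) * (wave n \<psi> (snd p) * wave n' \<psi>' (snd p))"
        by (simp add: tensor_def)
      also have "\<dots> = (1 / 2 * wave (m + m') (\<phi> + \<phi>') (fst p) + 1 / 2 * wave j \<rho> (fst p)) *
          (1 / 2 * wave (n + n') (\<psi> + \<psi>') (snd p) + 1 / 2 * wave i \<xi> (snd p))"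
        by (simp only: A B)
      finally show ?thesis by (simp add: tensor_def algebra_simps)
    qed
    then show ?case
      by (simp only:) (intro waves_add waves_cmult wave_in_waves)
  next
    case zero
    then show ?case using waves_cmult[OF wave_in_waves, of 0] by simp
  next
    case (add s t)
    then show ?case using waves_add by (fastforce simp: distrib_left)
  next
    case (cmult r s)
    then show ?case using waves_cmult by (fastforce simp: mult.left_commute)
  qed
next
  case zero
  then show ?case using waves_cmult[OF wave_in_waves, of 0] by simp
next
  case (add s t)
  then show ?case using waves_add by (fastforce simp: distrib_right)
next
  case (cmult r s)
  then show ?case using waves_cmult by (fastforce simp: mult.assoc)
qed

definition emb :: "torus \<Rightarrow> complex \<times> complex" where
  "emb p = (cis (fst p), cis (snd p))"

text \<open>Along \<open>emb\<close>, the real coordinates of the two complex factors are cos and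
  sin of the angles; the phase - pi / 2 produces sin and frequency zero produces constants. Since
  \<open>waves\<close> is an algebra, polynomials follow.\<close>

lemma polynomial_emb_in_waves:
  "real_polynomial_function P \<Longrightarrow> (\<lambda>p. P (emb p)) \<in> waves"
proof (induction rule: real_polynomial_function.induct)
  case (linear l)
  interpret bounded_linear l by fact
  have "emb p = cos (fst p) *\<^sub>R (1, 0) + sin (fst p) *\<^sub>R (\<i>, 0)
      + cos (snd p) *\<^sub>R (0, 1) + sin (snd p) *\<^sub>R (0, \<i>)" for p
    by (simp add: emb_def complex_eq_iff)
  then have "l (emb p) = l (1, 0) * tensor (wave 1 0) (wave 0 0) p + l (\<i>, 0) * tensor (wave 1 (- pi / 2)) (wave 0 0) p
     + l (0, 1) * tensor (wave 0 0) (wave 1 0) p + l (0, \<i>) * tensor (wave 0 0) (wave 1 (- pi / 2)) p" for p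
    by (simp only: add scale) (simp add: tensor_def wave_def cos_diff)
  then show ?case
    by (simp only:) (intro waves_add waves_cmult wave_in_waves)
next
  case (const c)
  show ?case using waves_cmult[OF wave_in_waves, of c 0 0 0 0] by (simp add: tensor_def wave_def)
qed (auto intro: waves_add waves_mult)

lemma doubly_periodic_int:
  assumes "doubly_periodic u"
  shows "u (x + 2 * pi * of_int j, y + 2 * pi * of_int k) = u (x, y)"
proof -
  have "u (x + 2 * pi * of_int j, y) = u (x, y)" for x y
  proof (induction j arbitrary: x rule: int_induct[where k = 0])
    case (step1 i)
    have "x + 2 * pi * of_int (i + 1) = x + 2 * pi * of_int i + 2 * pi" by (simp add: algebra_simps)
    then show ?case using assms step1 by (simp only: doubly_periodic_def)
  next
    case (step2 i)
    have "u (x + 2 * pi * of_int (i - 1), y) = u (x + 2 * pi * of_int (i - 1) + 2 * pi, y)"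
      using assms by (simp only: doubly_periodic_def)
    also have "x + 2 * pi * of_int (i - 1) + 2 * pi = x + 2 * pi * of_int i" by (simp add: algebra_simps)
    finally show ?case using step2 by simp
  qed simp
  moreover have "u (x, y + 2 * pi * of_int k) = u (x, y)" for x y
  proof (induction k arbitrary: y rule: int_induct[where k = 0])
    case (step1 i)
    have "y + 2 * pi * of_int (i + 1) = y + 2 * pi * of_int i + 2 * pi" by (simp add: algebra_simps)
    then show ?case using assms step1 by (simp only: doubly_periodic_def)
  next
    case (step2 i)
    have "u (x, y + 2 * pi * of_int (i - 1)) = u (x, y + 2 * pi * of_int (i - 1) + 2 * pi)"
      using assms by (simp only: doubly_periodic_def)
    also have "y + 2 * pi * of_int (i - 1) + 2 * pi = y + 2 * pi * of_int i" by (simp add: algebra_simps)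
    finally show ?case using step2 by simp
  qed simp
  ultimately show ?thesis by metis
qed

lemma doubly_periodic_Arg2pi:
  assumes "doubly_periodic u"
  shows "u (Arg2pi (cis x), Arg2pi (cis y)) = u (x, y)"
proof -
  have "\<exists>k::int. Arg2pi (cis x) = x + 2 * pi * k" for x
  proof -
    have "cis (Arg2pi (cis x)) = cis x"
      using Arg2pi_eq[of "cis x"] by (simp add: cis_conv_exp)
    then show ?thesis
      unfolding sin_cos_eq_iff[symmetric] by (simp add: complex_eq_iff)
  qed
  then show ?thesis using doubly_periodic_int[OF assms] by metis
qed

text \<open>\<open>Arg2pi\<close> jumps at the positive real axis, so continuity cannot come from
  composition. Instead, the preimage of a closed set is the image under \<open>emb\<close> of a
  compact part of the cell, hence closed.\<close>

lemma continuous_on_descend: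
  fixes u :: "torus \<Rightarrow> real"
  assumes "continuous_on UNIV u" "doubly_periodic u"
  shows "continuous_on (emb ` period_cell) (\<lambda>z. u (Arg2pi (fst z), Arg2pi (snd z)))" (is "continuous_on _ ?v")
proof -
  have v: "?v (emb p) = u p" for p
    using doubly_periodic_Arg2pi[OF assms(2)] by (cases p) (simp add: emb_def)
  have emb: "continuous_on S emb" for S
    unfolding emb_def[abs_def] cis_conv_exp by (intro continuous_intros)
  then have "closed (emb ` period_cell)"
    by (intro compact_imp_closed compact_continuous_image compact_cbox)
  moreover have "closed (?v -` B \<inter> emb ` period_cell)" if "closed B" for B
  proof -
    have "?v -` B \<inter> emb ` period_cell = emb ` (period_cell \<inter> u -` B)" using v by fastforce
    moreover have "closed (u -` B)"
      using assms(1) that by (simp add: continuous_on_closed_vimage)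
    then have "compact (period_cell \<inter> u -` B)" by (intro compact_Int_closed compact_cbox)
    ultimately show ?thesis
      using emb by (metis compact_continuous_image compact_imp_closed)
  qed
  ultimately show ?thesis by (simp add: continuous_on_closed_vimage)
qed

text \<open>A trigonometric polynomial h within e of u is orthogonal to u, so the integral of u^2
  equals that of u (u - h) and is at most e times the integral of |u|, for every e > 0.\<close>

lemma Fourier_complete_wave:
  assumes "u \<in> smooth_periodic" and FF0: "\<And>m n \<phi> \<psi>. fourier (wave m \<phi>) (wave n \<psi>) u = 0"
  shows "u = (\<lambda>p. 0)"
proof -
  have cont: "continuous_on UNIV u" and dp: "doubly_periodic u"
    using assms(1) by (auto simp: smooth_periodic_continuous) (simp add: smooth_periodic_def del: smooth_periodic_smooth)
  have waves: "h \<in> smooth_periodic \<and> integral period_cell (\<lambda>p. u p * h p) = 0" if "h \<in> waves" for h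
    using that
  proof (induction rule: waves_induct)
    case (wave m n \<phi> \<psi>)
    then show ?case using FF0[of m \<phi> n \<psi>] tensor_smooth_periodic[OF trig_pair_wave trig_pair_wave] by (simp add: fourier_def)
  next
    case (add s t)
    then show ?case using assms(1) by (simp add: distrib_left integral_add)
  next
    case (cmult r s)
    then show ?case by (simp add: mult.left_commute[of _ r])
  qed simp
  let ?I = "integral period_cell (\<lambda>p. u p * u p)" and ?M = "integral period_cell (\<lambda>p. \<bar>u p\<bar>)"
  have int: "(\<lambda>p. \<bar>u p\<bar>) integrable_on period_cell"
    using smooth_periodic_continuous[OF assms(1)] by (intro integrable_continuous continuous_intros)
  have bound: "?I \<le> e * ?M" if e: "e > 0" for e
  proof -
    have "compact (emb ` period_cell)"
      unfolding emb_def[abs_def] cis_conv_exp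
      by (intro compact_continuous_image compact_cbox continuous_intros)
    then obtain P where P: "real_polynomial_function P"
      "\<And>z. z \<in> emb ` period_cell \<Longrightarrow> \<bar>u (Arg2pi (fst z), Arg2pi (snd z)) - P z\<bar> < e"
      using Stone_Weierstrass_real_polynomial_function[OF _ continuous_on_descend[OF cont dp] e] by blast
    define h where "h = (\<lambda>p. P (emb p))"
    have h: "h \<in> smooth_periodic" "integral period_cell (\<lambda>p. u p * h p) = 0"
      using waves[OF polynomial_emb_in_waves[OF P(1)]] by (auto simp: h_def)
    have close: "\<bar>u p - h p\<bar> < e" if "p \<in> period_cell" for p
    proof -
      have "u (Arg2pi (fst (emb p)), Arg2pi (snd (emb p))) = u p"
        using doubly_periodic_Arg2pi[OF dp] by (cases p) (simp add: emb_def)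
      then show ?thesis using P(2)[OF imageI[OF that]] by (simp add: h_def)
    qed
    have "?I = integral period_cell (\<lambda>p. u p * (u p - h p))"
      using assms(1) h by (simp add: right_diff_distrib integral_diff)
    also have "\<dots> \<le> integral period_cell (\<lambda>p. e * \<bar>u p\<bar>)"
    proof (rule integral_le)
      show "u p * (u p - h p) \<le> e * \<bar>u p\<bar>" if "p \<in> period_cell" for p
      proof -
        have "u p * (u p - h p) \<le> \<bar>u p\<bar> * \<bar>u p - h p\<bar>" by (simp flip: abs_mult)
        also have "\<dots> \<le> \<bar>u p\<bar> * e" using close[OF that] by (intro mult_left_mono) auto
        finally show ?thesis by (simp add: mult.commute)
      qed
    qed (use assms(1) h integrable_cmul[OF int, of e] in simp_all)
    finally show ?thesis by simp
  qed
  have "?I \<le> 0"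
  proof (rule field_le_epsilon)
    fix e :: real assume "e > 0"
    have M: "?M \<ge> 0" by (rule integral_nonneg[OF int]) simp
    \<comment> \<open>The summand 1 keeps the denominator positive even when the integral of |u| is
      zero.\<close>
    have "?I \<le> e / (?M + 1) * ?M" using bound[of "e / (?M + 1)"] \<open>e > 0\<close> M by simp
    also have "\<dots> \<le> e" using \<open>e > 0\<close> M by (simp add: field_simps)
    finally show "?I \<le> 0 + e" by simp
  qed
  moreover have "?I \<ge> 0" using assms(1) by (intro integral_nonneg) auto
  ultimately have "?I = 0" by simp
  moreover have "continuous_on period_cell (\<lambda>p. u p * u p)"
    using smooth_periodic_continuous[OF assms(1)] by (intro continuous_intros)
  moreover have "box (0, 0) (2 * pi, 2 * pi) \<noteq> ({} :: torus set)"
    by (auto simp: box_ne_empty Basis_prod_def)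
  ultimately have zero: "u p = 0" if "p \<in> period_cell" for p
    using that integral_cbox_eq_0_iff[of "(0, 0)" "(2 * pi, 2 * pi)" "\<lambda>p. u p * u p"] by simp
  show ?thesis
  proof
    fix p :: torus
    \<comment> \<open>\<open>Arg2pi\<close> takes values in [0, 2 pi), so every point has a
      representative in the cell.\<close>
    have "(Arg2pi (cis x), Arg2pi (cis y)) \<in> period_cell" for x y
      using Arg2pi[of "cis x"] Arg2pi[of "cis y"] by (simp add: less_imp_le)
    then show "u p = 0"
      using doubly_periodic_Arg2pi[OF dp] zero by (metis prod.collapse)
  qed
qed

text \<open>Waves with a phase suit products; these two tests per frequency suffice for vanishing
  and make the exceptional modes a finite check. At frequency zero the second one is the zero
  function.\<close>

definition harmonics :: "nat \<Rightarrow> (real \<Rightarrow> real) set" where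
  "harmonics m = {\<lambda>x. cos (real m * x), \<lambda>x. sin (real m * x)}"

lemma trig_pair_harmonics:
  assumes "f \<in> harmonics m" obtains f' where "trig_pair m f f'"
proof -
  have "wave m 0 = (\<lambda>x. cos (real m * x))" "wave m (- pi / 2) = (\<lambda>x. sin (real m * x))"
    by (auto simp: wave_def cos_diff)
  then show thesis
    using assms that trig_pair_wave by (auto simp: harmonics_def) metis+
qed

lemma fourier_wave:
  assumes u: "u \<in> smooth_periodic" and "\<And>f g. f \<in> harmonics m \<Longrightarrow> g \<in> harmonics n \<Longrightarrow> fourier f g u = 0"
  shows "fourier (wave m \<phi>) (wave n \<psi>) u = 0"
proof -
  let ?c = "\<lambda>m x. cos (real m * x)" and ?s = "\<lambda>m x. sin (real m * x)"
  have smooth_periodic: "tensor f g \<in> smooth_periodic" if "f \<in> harmonics m" "g \<in> harmonics n" for f g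
    using that trig_pair_harmonics tensor_smooth_periodic by metis
  have [simp]: "?c m \<in> harmonics m" "?s m \<in> harmonics m" for m by (auto simp: harmonics_def)
  have int: "(\<lambda>p. r * (u p * tensor f g p)) integrable_on period_cell" if "f \<in> harmonics m" "g \<in> harmonics n" for f g r
    using smooth_periodic[OF that] u by simp
  have "fourier (wave m \<phi>) (wave n \<psi>) u = integral period_cell (\<lambda>p.
      (cos \<phi> * cos \<psi>) * (u p * tensor (?c m) (?c n) p) - (cos \<phi> * sin \<psi>) * (u p * tensor (?c m) (?s n) p)
      - (sin \<phi> * cos \<psi>) * (u p * tensor (?s m) (?c n) p) + (sin \<phi> * sin \<psi>) * (u p * tensor (?s m) (?s n) p))"
    unfolding fourier_def by (rule arg_cong[where f = "integral period_cell"])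
      (auto simp: tensor_def wave_def cos_add algebra_simps)
  also have "\<dots> = (cos \<phi> * cos \<psi>) * fourier (?c m) (?c n) u - (cos \<phi> * sin \<psi>) * fourier (?c m) (?s n) u
      - (sin \<phi> * cos \<psi>) * fourier (?s m) (?c n) u + (sin \<phi> * sin \<psi>) * fourier (?s m) (?s n) u"
    using int by (simp add: fourier_def integral_add integral_diff integrable_add integrable_diff del: integral_mult_right)
       (simp add: fourier_def)
  finally show ?thesis using assms(2) by simp
qed

lemma Fourier_complete:
  assumes "u \<in> smooth_periodic" "\<And>m n f g. f \<in> harmonics m \<Longrightarrow> g \<in> harmonics n \<Longrightarrow> fourier f g u = 0"
  shows "u = (\<lambda>p. 0)"
  using assms by (intro Fourier_complete_wave fourier_wave)

section \<open>The mode equations\<close>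

text \<open>Integrating \<open>D1 c\<close> by parts against f' g produces f'' g = - x f g, which
  leads back to the coefficient of c against f g; \<open>D1 a\<close> against f g leads to f' g.
  Hence the four unknowns are closed under the operators, and only the squared frequencies
  appear.\<close>

lemma fourier_L:
  fixes m n :: nat
  assumes tf: "trig_pair m f f'" and tg: "trig_pair n g g'"
  defines "x \<equiv> (real m)\<^sup>2" and "y \<equiv> (real n)\<^sup>2"
  shows "a \<in> smooth_periodic \<Longrightarrow> fourier f' g (lap a) = 4 * (x + y) * fourier f' g a"
    "b \<in> smooth_periodic \<Longrightarrow> fourier f g' (lap b) = 4 * (x + y) * fourier f g' b"
    "a \<in> smooth_periodic \<Longrightarrow> c \<in> smooth_periodic \<Longrightarrow> d \<in> smooth_periodic \<Longrightarrow> fourier f' g (LA a c d) =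
      (4 * (x + y) + 3) * fourier f' g a + 4 * x * fourier f g c - 8 * x * fourier f g d"
    "b \<in> smooth_periodic \<Longrightarrow> c \<in> smooth_periodic \<Longrightarrow> d \<in> smooth_periodic \<Longrightarrow> fourier f g' (LB b c d) =
      (4 * (x + y) + 3) * fourier f g' b + 4 * y * fourier f g c + 8 * y * fourier f g d"
    "a \<in> smooth_periodic \<Longrightarrow> b \<in> smooth_periodic \<Longrightarrow> c \<in> smooth_periodic \<Longrightarrow> fourier f g (LC a b c) =
      (4 * (x + y) + 2) * fourier f g c + 4 * fourier f' g a + 4 * fourier f g' b"
    "a \<in> smooth_periodic \<Longrightarrow> b \<in> smooth_periodic \<Longrightarrow> d \<in> smooth_periodic \<Longrightarrow> fourier f g (LD a b d) =
      (4 * (x + y) + 4) * fourier f g d - 4 * fourier f' g a + 4 * fourier f g' b"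
proof -
  note tf' = trig_pair_deriv[OF tf] and tg' = trig_pair_deriv[OF tg]
  note [simp] = tensor_smooth_periodic[OF tf tg] tensor_smooth_periodic[OF tf' tg] tensor_smooth_periodic[OF tf tg'] tensor_smooth_periodic[OF tf' tg']
    fourier_D[OF tf tg] fourier_D[OF tf' tg] fourier_D[OF tf tg'] fourier_D[OF tf' tg'] fourier_linear
  show "a \<in> smooth_periodic \<Longrightarrow> fourier f' g (lap a) = 4 * (x + y) * fourier f' g a"
    "b \<in> smooth_periodic \<Longrightarrow> fourier f g' (lap b) = 4 * (x + y) * fourier f g' b"
    "a \<in> smooth_periodic \<Longrightarrow> c \<in> smooth_periodic \<Longrightarrow> d \<in> smooth_periodic \<Longrightarrow> fourier f' g (LA a c d) =
      (4 * (x + y) + 3) * fourier f' g a + 4 * x * fourier f g c - 8 * x * fourier f g d"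
    "b \<in> smooth_periodic \<Longrightarrow> c \<in> smooth_periodic \<Longrightarrow> d \<in> smooth_periodic \<Longrightarrow> fourier f g' (LB b c d) =
      (4 * (x + y) + 3) * fourier f g' b + 4 * y * fourier f g c + 8 * y * fourier f g d"
    "a \<in> smooth_periodic \<Longrightarrow> b \<in> smooth_periodic \<Longrightarrow> c \<in> smooth_periodic \<Longrightarrow> fourier f g (LC a b c) =
      (4 * (x + y) + 2) * fourier f g c + 4 * fourier f' g a + 4 * fourier f g' b"
    "a \<in> smooth_periodic \<Longrightarrow> b \<in> smooth_periodic \<Longrightarrow> d \<in> smooth_periodic \<Longrightarrow> fourier f g (LD a b d) =
      (4 * (x + y) + 4) * fourier f g d - 4 * fourier f' g a + 4 * fourier f g' b"
    by (simp add: LA_def LB_def LC_def LD_def lap_def[abs_def], simp add: x_def y_def algebra_simps)+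
qed

lemma Ker_mode_system:
  fixes m n :: nat
  assumes K: "frame_field a b c d \<in> Ker_I2 \<Phi>" and tf: "trig_pair m f f'" and tg: "trig_pair n g g'"
  defines "x \<equiv> (real m)\<^sup>2" and "y \<equiv> (real n)\<^sup>2"
  defines "\<alpha> \<equiv> fourier f' g a" and "\<beta> \<equiv> fourier f g' b" and "\<kappa> \<equiv> fourier f g c" and "\<delta> \<equiv> fourier f g d"
  shows "((x + y)\<^sup>2 + (x + y) + 3 * x) * \<alpha> - x * \<beta> + 2 * x * (x + y) * \<kappa> - 2 * x * (2 * (x + y) + 1) * \<delta> = 0"
    "((x + y)\<^sup>2 + (x + y) + 3 * y) * \<beta> - y * \<alpha> + 2 * y * (x + y) * \<kappa> + 2 * y * (2 * (x + y) + 1) * \<delta> = 0"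
    "2 * (x + y) * (\<alpha> + \<beta>) + ((x + y)\<^sup>2 + (x + y) - 1) * \<kappa> - 2 * (x - y) * \<delta> = 0"
    "(2 * (x + y) + 1) * (\<beta> - \<alpha>) - (x - y) * \<kappa> + ((x + y)\<^sup>2 + 3 * (x + y)) * \<delta> = 0"
proof -
  have smooth_periodic [simp]: "a \<in> smooth_periodic" "b \<in> smooth_periodic" "c \<in> smooth_periodic" "d \<in> smooth_periodic"
    and R: "RA a b c d = (\<lambda>p. 0)" "RB a b c d = (\<lambda>p. 0)" "RC a b c d = (\<lambda>p. 0)" "RD a b c d = (\<lambda>p. 0)"
    using K by (auto simp: Ker_I2_frame_field)
  note tf' = trig_pair_deriv[OF tf] and tg' = trig_pair_deriv[OF tg]
  note [simp] = tensor_smooth_periodic[OF tf tg] tensor_smooth_periodic[OF tf' tg] tensor_smooth_periodic[OF tf tg']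
    fourier_D[OF tf tg] fourier_D[OF tf' tg] fourier_D[OF tf tg'] fourier_linear fourier_L[OF tf tg]
  have z: "fourier f g (\<lambda>p. 0) = 0" for f g by (simp add: fourier_def)
  define l where "l = x + y"
  have "0 = fourier f' g (RA a b c d)" "0 = fourier f g' (RB a b c d)" "0 = fourier f g (RC a b c d)" "0 = fourier f g (RD a b c d)"
    by (simp_all add: R z)
  then have "0 = (4 * l + 3) * ((4 * l + 3) * \<alpha> + 4 * x * \<kappa> - 8 * x * \<delta>)
      + 4 * x * ((4 * l + 2) * \<kappa> + 4 * \<alpha> + 4 * \<beta>) - 8 * x * ((4 * l + 4) * \<delta> - 4 * \<alpha> + 4 * \<beta>)
      - 3 * ((4 * l + 3) * \<alpha> + 4 * x * \<kappa> - 8 * x * \<delta>) + 4 * l * \<alpha> - 8 * x * \<kappa>"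
    "0 = (4 * l + 3) * ((4 * l + 3) * \<beta> + 4 * y * \<kappa> + 8 * y * \<delta>)
      + 4 * y * ((4 * l + 2) * \<kappa> + 4 * \<alpha> + 4 * \<beta>) + 8 * y * ((4 * l + 4) * \<delta> - 4 * \<alpha> + 4 * \<beta>)
      - 3 * ((4 * l + 3) * \<beta> + 4 * y * \<kappa> + 8 * y * \<delta>) + 4 * l * \<beta> - 8 * y * \<kappa>"
    "0 = (4 * l + 2) * ((4 * l + 2) * \<kappa> + 4 * \<alpha> + 4 * \<beta>) + 4 * ((4 * l + 3) * \<alpha> + 4 * x * \<kappa> - 8 * x * \<delta>)
      + 4 * ((4 * l + 3) * \<beta> + 4 * y * \<kappa> + 8 * y * \<delta>) - 4 * ((4 * l + 2) * \<kappa> + 4 * \<alpha> + 4 * \<beta>)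
      - 4 * \<alpha> - 4 * \<beta> - 12 * \<kappa>"
    "0 = (4 * l + 4) * ((4 * l + 4) * \<delta> - 4 * \<alpha> + 4 * \<beta>) - 4 * ((4 * l + 3) * \<alpha> + 4 * x * \<kappa> - 8 * x * \<delta>)
      + 4 * ((4 * l + 3) * \<beta> + 4 * y * \<kappa> + 8 * y * \<delta>) - 4 * ((4 * l + 4) * \<delta> - 4 * \<alpha> + 4 * \<beta>)
      - 4 * \<alpha> + 4 * \<beta>"
    unfolding RA_def RB_def RC_def RD_def
    by (simp_all add: l_def \<alpha>_def \<beta>_def \<kappa>_def \<delta>_def flip: x_def y_def)
  \<comment> \<open>Each equation is the corresponding one above divided by 16.\<close>
  then show "((x + y)\<^sup>2 + (x + y) + 3 * x) * \<alpha> - x * \<beta> + 2 * x * (x + y) * \<kappa> - 2 * x * (2 * (x + y) + 1) * \<delta> = 0"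
    "((x + y)\<^sup>2 + (x + y) + 3 * y) * \<beta> - y * \<alpha> + 2 * y * (x + y) * \<kappa> + 2 * y * (2 * (x + y) + 1) * \<delta> = 0"
    "2 * (x + y) * (\<alpha> + \<beta>) + ((x + y)\<^sup>2 + (x + y) - 1) * \<kappa> - 2 * (x - y) * \<delta> = 0"
    "(2 * (x + y) + 1) * (\<beta> - \<alpha>) - (x - y) * \<kappa> + ((x + y)\<^sup>2 + 3 * (x + y)) * \<delta> = 0"
    unfolding l_def by algebra+
qed

text \<open>In the invariants \<open>l = x + y\<close>, \<open>u = x - y\<close>, and with \<open>p = \<alpha> + \<beta>\<close>, \<open>q = \<beta> - \<alpha>\<close>, the
  determinant of the mode system is a quadratic polynomial in \<open>u\<^sup>2\<close>.\<close>

lemma mode_det_pos: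
  fixes l w :: real
  assumes "l \<ge> 4" "0 \<le> w" "w \<le> l\<^sup>2"
  shows "l^8 - 3 * l^7 + 4 * l^6 - 7 * l^5 + 7 * l^4 - 4 * l^3 + 4 * l\<^sup>2
    - w * (4 * l^4 - 14 * l^3 + 14 * l\<^sup>2 + 2) + 4 * w\<^sup>2 > 0"
proof -
  obtain t where l: "l = 4 + t" and t: "t \<ge> 0" using assms(1) by (metis add_diff_cancel_left' diff_ge_0_iff_ge diff_add_cancel add.commute)
  \<comment> \<open>The term 4 w^2 is dropped and the linear term is estimated at the extreme value
    w = l^2, which needs this sign; expanded in t, all coefficients are positive.\<close>
  have "4 * l^4 - 14 * l^3 + 14 * l\<^sup>2 + 2 \<ge> 0"
    using t unfolding l by (simp add: power2_eq_square power3_eq_cube power4_eq_xxxx algebra_simps)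
  then have "w * (4 * l^4 - 14 * l^3 + 14 * l\<^sup>2 + 2) \<le> l\<^sup>2 * (4 * l^4 - 14 * l^3 + 14 * l\<^sup>2 + 2)"
    using assms by (intro mult_right_mono)
  moreover have "l^8 - 3 * l^7 + 4 * l^6 - 7 * l^5 + 7 * l^4 - 4 * l^3 + 4 * l\<^sup>2 - l\<^sup>2 * (4 * l^4 - 14 * l^3 + 14 * l\<^sup>2 + 2) > 0"
  proof -
    have factor: "l^8 - 3 * l^7 + 4 * l^6 - 7 * l^5 + 7 * l^4 - 4 * l^3 + 4 * l\<^sup>2 - l\<^sup>2 * (4 * l^4 - 14 * l^3 + 14 * l\<^sup>2 + 2)
      = l\<^sup>2 * (l^6 - 3 * l^5 + 7 * l^3 - 7 * l\<^sup>2 - 4 * l + 2)" by algebra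
    \<comment> \<open>Uses l - 3 = t + 1, so that l^6 - 3 l^5 = l^5 t + l^5, and the last power
      absorbs - 4 l.\<close>
    have "l^6 - 3 * l^5 + 7 * l^3 - 7 * l\<^sup>2 - 4 * l + 2 =
        l^5 * t + l^4 * l + 7 * l\<^sup>2 * (l - 1) - 4 * l + 2" unfolding l by algebra
    moreover have "l^4 * l \<ge> 4 * l"
    proof -
      have "4 ^ 4 \<le> l^4" using assms(1) by (intro power_mono) auto
      then show ?thesis using assms(1) by (intro mult_right_mono) auto
    qed
    moreover have "l^5 * t \<ge> 0" "7 * l\<^sup>2 * (l - 1) \<ge> 0" using assms(1) t by auto
    ultimately have "l^6 - 3 * l^5 + 7 * l^3 - 7 * l\<^sup>2 - 4 * l + 2 > 0" by linarith
    with factor show ?thesis using assms(1) by simp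
  qed
  ultimately show ?thesis by (smt (verit) zero_le_power2)
qed

text \<open>Exchanging the circles fixes l, p and \<kappa> and changes the sign of u, q and
  \<delta>. In these variables the equations are even or odd, which is why the determinant D
  involves only u^2; it is positive because u^2 \<le> l^2.\<close>

lemma mode_system_regular:
  fixes x y :: real
  assumes e: "((x + y)\<^sup>2 + (x + y) + 3 * x) * \<alpha> - x * \<beta> + 2 * x * (x + y) * \<kappa> - 2 * x * (2 * (x + y) + 1) * \<delta> = 0"
    "((x + y)\<^sup>2 + (x + y) + 3 * y) * \<beta> - y * \<alpha> + 2 * y * (x + y) * \<kappa> + 2 * y * (2 * (x + y) + 1) * \<delta> = 0"
    "2 * (x + y) * (\<alpha> + \<beta>) + ((x + y)\<^sup>2 + (x + y) - 1) * \<kappa> - 2 * (x - y) * \<delta> = 0"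
    "(2 * (x + y) + 1) * (\<beta> - \<alpha>) - (x - y) * \<kappa> + ((x + y)\<^sup>2 + 3 * (x + y)) * \<delta> = 0"
    and "x \<ge> 0" "y \<ge> 0" "x + y \<ge> 4"
  shows "\<alpha> = 0" "\<beta> = 0" "\<kappa> = 0" "\<delta> = 0"
proof -
  define l u p q where luv: "l = x + y" "u = x - y" "p = \<alpha> + \<beta>" "q = \<beta> - \<alpha>"
  define D where "D = l^8 - 3 * l^7 + 4 * l^6 - 7 * l^5 + 7 * l^4 - 4 * l^3 + 4 * l\<^sup>2
    - u\<^sup>2 * (4 * l^4 - 14 * l^3 + 14 * l\<^sup>2 + 2) + 4 * (u\<^sup>2)\<^sup>2"
  have "(x - y)\<^sup>2 \<le> (x + y)\<^sup>2" using assms(5,6) by (simp add: power2_eq_square algebra_simps)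
  then have D: "D \<noteq> 0"
    using mode_det_pos[of l "u\<^sup>2"] assms(5-) by (simp add: luv D_def)
  \<comment> \<open>\<open>r0\<close> is the sum of the first two equations and \<open>r1\<close>
    the second minus the first.\<close>
  have r0: "(l\<^sup>2 + 2 * l) * p - 2 * u * q + 2 * l\<^sup>2 * \<kappa> - 2 * u * (2 * l + 1) * \<delta> = 0"
    using e(1,2) unfolding luv by algebra
  have r1: "- u * p + (l\<^sup>2 + 3 * l) * q - 2 * u * l * \<kappa> + 2 * l * (2 * l + 1) * \<delta> = 0"
    using e(1,2) unfolding luv by algebra
  have r2: "2 * l * p + (l\<^sup>2 + l - 1) * \<kappa> - 2 * u * \<delta> = 0"
    using e(3) by (simp add: luv)
  have r3: "(2 * l + 1) * q - u * \<kappa> + (l\<^sup>2 + 3 * l) * \<delta> = 0"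
    using e(4) by (simp add: luv)
  (* Cramer: the multipliers are the cofactors of the coefficient matrix of r0-r3. *)
  have P: "D * p = 0"
  proof -
    have "D * p = (l^6 - l^5 - 2 * l^4 + l^3 + 6 * l^2 * u^2 - 3 * l^2 - 2 * l * u^2 + 2 * l) * ((l\<^sup>2 + 2 * l) * p - 2 * u * q + 2 * l\<^sup>2 * \<kappa> - 2 * u * (2 * l + 1) * \<delta>)
      + (- 6 * l^4 * u + 6 * l^2 * u - 4 * u^3 + 2 * u) * (- u * p + (l\<^sup>2 + 3 * l) * q - 2 * u * l * \<kappa> + 2 * l * (2 * l + 1) * \<delta>)
      + (- 2 * l^6 + 4 * l^5 - 2 * l^4 - 8 * l^3 * u^2 + 4 * l^3 + 2 * l^2 * u^2 - 2 * l * u^2) * (2 * l * p + (l\<^sup>2 + l - 1) * \<kappa> - 2 * u * \<delta>)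
      + (4 * l^5 * u + 6 * l^4 * u - 8 * l^3 * u - 4 * l^2 * u + 8 * l * u^3 - 2 * l * u) * ((2 * l + 1) * q - u * \<kappa> + (l\<^sup>2 + 3 * l) * \<delta>)"
      unfolding D_def by algebra
    then show ?thesis unfolding r0 r1 r2 r3 by simp
  qed
  have Qq: "D * q = 0"
  proof -
    have "D * q = (- 3 * l^4 * u + 6 * l^2 * u - 3 * l * u - 2 * u^3) * ((l\<^sup>2 + 2 * l) * p - 2 * u * q + 2 * l\<^sup>2 * \<kappa> - 2 * u * (2 * l + 1) * \<delta>)
      + (l^6 + 2 * l^5 - 2 * l^4 + l^3 + 6 * l^2 * u^2 - 6 * l^2) * (- u * p + (l\<^sup>2 + 3 * l) * q - 2 * u * l * \<kappa> + 2 * l * (2 * l + 1) * \<delta>)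
      + (2 * l^5 * u + 4 * l^4 * u - 4 * l^3 * u - 4 * l^2 * u + 4 * l * u^3 + 2 * u^3) * (2 * l * p + (l\<^sup>2 + l - 1) * \<kappa> - 2 * u * \<delta>)
      + (- 4 * l^6 + 2 * l^5 - 2 * l^4 - 8 * l^3 * u^2 + 6 * l^3 + 2 * l^2 * u^2 + 4 * l^2 - 2 * l * u^2 - 2 * u^2) * ((2 * l + 1) * q - u * \<kappa> + (l\<^sup>2 + 3 * l) * \<delta>)"
      unfolding D_def by algebra
    then show ?thesis unfolding r0 r1 r2 r3 by simp
  qed
  have K: "D * \<kappa> = 0"
  proof -
    have "D * \<kappa> = (- 2 * l^5 + 4 * l^4 - 2 * l^3 + 4 * l^2 - 4 * l * u^2 - 2 * u^2) * ((l\<^sup>2 + 2 * l) * p - 2 * u * q + 2 * l\<^sup>2 * \<kappa> - 2 * u * (2 * l + 1) * \<delta>)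
      + (8 * l^3 * u - 6 * l^2 * u) * (- u * p + (l\<^sup>2 + 3 * l) * q - 2 * u * l * \<kappa> + 2 * l * (2 * l + 1) * \<delta>)
      + (l^6 - 3 * l^4 + 6 * l^2 * u^2 - 4 * l^2 + 2 * l * u^2 + 2 * u^2) * (2 * l * p + (l\<^sup>2 + l - 1) * \<kappa> - 2 * u * \<delta>)
      + (- 6 * l^4 * u - 2 * l^3 * u + 8 * l^2 * u - 4 * u^3) * ((2 * l + 1) * q - u * \<kappa> + (l\<^sup>2 + 3 * l) * \<delta>)"
      unfolding D_def by algebra
    then show ?thesis unfolding r0 r1 r2 r3 by simp
  qed
  have Dl: "D * \<delta> = 0"
  proof -
    have "D * \<delta> = (4 * l^3 * u - 5 * l^2 * u + l * u + u) * ((l\<^sup>2 + 2 * l) * p - 2 * u * q + 2 * l\<^sup>2 * \<kappa> - 2 * u * (2 * l + 1) * \<delta>)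
      + (- 2 * l^5 + l^4 - l^3 + 3 * l^2 - 4 * l * u^2 + 2 * l) * (- u * p + (l\<^sup>2 + 3 * l) * q - 2 * u * l * \<kappa> + 2 * l * (2 * l + 1) * \<delta>)
      + (- 3 * l^4 * u - l^3 * u + 4 * l^2 * u - 2 * u^3) * (2 * l * p + (l\<^sup>2 + l - 1) * \<kappa> - 2 * u * \<delta>)
      + (l^6 + 2 * l^5 - 2 * l^4 + l^3 + 6 * l^2 * u^2 - 6 * l^2 - 2 * l * u^2 + 2 * u^2) * ((2 * l + 1) * q - u * \<kappa> + (l\<^sup>2 + 3 * l) * \<delta>)"
      unfolding D_def by algebra
    then show ?thesis unfolding r0 r1 r2 r3 by simp
  qed
  show "\<kappa> = 0" "\<delta> = 0" using K Dl D by auto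
  show "\<alpha> = 0" "\<beta> = 0" using P Qq D by (auto simp: luv)
qed

text \<open>Covers what the mode system misses: for constant f the test f' g is zero. Testing
  \<open>RA\<close> against 1 times g removes all \<open>D1\<close> terms and leaves the factor (4 y
  + 3)^2 - 3 (4 y + 3) + 4 y = 16 y^2 + 16 y, positive for n \<noteq> 0. The second claim is the
  same with the circles exchanged.\<close>

lemma Ker_mode_constant:
  fixes m n :: nat
  assumes K: "frame_field a b c d \<in> Ker_I2 \<Phi>"
  shows "trig_pair n g g' \<Longrightarrow> n \<noteq> 0 \<Longrightarrow> fourier (\<lambda>x. 1) g a = 0"
    and "trig_pair m f f' \<Longrightarrow> m \<noteq> 0 \<Longrightarrow> fourier f (\<lambda>x. 1) b = 0"
proof -
  have [simp]: "a \<in> smooth_periodic" "b \<in> smooth_periodic" "c \<in> smooth_periodic" "d \<in> smooth_periodic"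
    and R: "RA a b c d = (\<lambda>p. 0)" "RB a b c d = (\<lambda>p. 0)"
    using K by (auto simp: Ker_I2_frame_field)
  note c = trig_pair_const[of 1]
  have z: "fourier f g (\<lambda>p. 0) = 0" for f g by (simp add: fourier_def)
  {
    assume tg: "trig_pair n g g'" and n: "n \<noteq> 0"
    note tg' = trig_pair_deriv[OF tg]
    define y where "y = (real n)\<^sup>2"
    note [simp] = tensor_smooth_periodic[OF c tg] tensor_smooth_periodic[OF c tg'] fourier_D[OF c tg] fourier_D[OF c tg'] fourier_linear
    have lap: "fourier (\<lambda>x. 1) g (lap u) = 4 * y * fourier (\<lambda>x. 1) g u" if "u \<in> smooth_periodic" for u
      using that by (simp add: lap_def[abs_def] y_def)
    have LA: "fourier (\<lambda>x. 1) g (LA u v w) = (4 * y + 3) * fourier (\<lambda>x. 1) g u"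
      if "u \<in> smooth_periodic" "v \<in> smooth_periodic" "w \<in> smooth_periodic" for u v w
      using that by (simp add: LA_def lap) (simp add: algebra_simps)
    have "fourier (\<lambda>x. 1) g (RA a b c d) = (16 * y\<^sup>2 + 16 * y) * fourier (\<lambda>x. 1) g a"
      unfolding RA_def by (simp add: LA lap) (simp add: algebra_simps power2_eq_square)
    moreover have "16 * y\<^sup>2 + 16 * y > 0" using n by (simp add: y_def add_pos_pos)
    ultimately show "fourier (\<lambda>x. 1) g a = 0" by (simp add: R z)
  next
    assume tf: "trig_pair m f f'" and m: "m \<noteq> 0"
    note tf' = trig_pair_deriv[OF tf]
    define x where "x = (real m)\<^sup>2"
    note [simp] = tensor_smooth_periodic[OF tf c] tensor_smooth_periodic[OF tf' c] fourier_D[OF tf c] fourier_D[OF tf' c] fourier_linear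
    have lap: "fourier f (\<lambda>x. 1) (lap u) = 4 * x * fourier f (\<lambda>x. 1) u" if "u \<in> smooth_periodic" for u
      using that by (simp add: lap_def[abs_def] x_def)
    have LB: "fourier f (\<lambda>x. 1) (LB u v w) = (4 * x + 3) * fourier f (\<lambda>x. 1) u"
      if "u \<in> smooth_periodic" "v \<in> smooth_periodic" "w \<in> smooth_periodic" for u v w
      using that by (simp add: LB_def lap) (simp add: algebra_simps)
    have "fourier f (\<lambda>x. 1) (RB a b c d) = (16 * x\<^sup>2 + 16 * x) * fourier f (\<lambda>x. 1) b"
      unfolding RB_def by (simp add: LB lap) (simp add: algebra_simps power2_eq_square)
    moreover have "16 * x\<^sup>2 + 16 * x > 0" using m by (simp add: x_def add_pos_pos)
    ultimately show "fourier f (\<lambda>x. 1) b = 0" by (simp add: R z)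
  }
qed

text \<open>The volume element of the torus is a quarter of Lebesgue measure in the angles; the
  constant is dropped since only orthogonality matters.\<close>

definition l2_inner :: "(torus \<Rightarrow> real ^ 5) \<Rightarrow> (torus \<Rightarrow> real ^ 5) \<Rightarrow> real" where
  "l2_inner V W = integral period_cell (\<lambda>p. V p \<bullet> W p)"

lemma l2_inner_scaleR_right: "l2_inner V (r *\<^sub>R W) = r * l2_inner V W"
  by (simp add: l2_inner_def scaleR_fun_def)

lemma inner_frame_field_frame_field:
  "frame_field a b c d p \<bullet> frame_field a' b' c' d' p = a p * a' p + b p * b' p + c p * c' p + d p * (2 * d' p)"
  unfolding frame_field_def[of a b c d] by (simp add: inner_add_left)

text \<open>Pairing with a kernel field is a linear form in the very unknowns of the mode system,
  hence one more equation for it. The coefficient 2 at d is the squared length of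
  \<open>N\<close>.\<close>

lemma l2_inner_mode11:
  assumes tf: "trig_pair m f f'" and tg: "trig_pair n g g'"
    and [simp]: "a \<in> smooth_periodic" "b \<in> smooth_periodic" "c \<in> smooth_periodic" "d \<in> smooth_periodic"
  shows "l2_inner (frame_field a b c d) (frame_field (\<lambda>p. - tensor f' g p) (\<lambda>p. tensor f g' p) (\<lambda>p. 0) (\<lambda>p. - tensor f g p))
    = - fourier f' g a + fourier f g' b - 2 * fourier f g d"
  using tensor_smooth_periodic[OF tf tg] tensor_smooth_periodic[OF trig_pair_deriv[OF tf] tg] tensor_smooth_periodic[OF tf trig_pair_deriv[OF tg]]
  by (simp add: l2_inner_def inner_frame_field_frame_field fourier_def integral_add integral_diff mult.left_commute[of _ 2])

lemma l2_inner_mode10: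
  assumes tf: "trig_pair m f f'" and [simp]: "a \<in> smooth_periodic" "b \<in> smooth_periodic" "c \<in> smooth_periodic" "d \<in> smooth_periodic"
  shows "l2_inner (frame_field a b c d) (frame_field (\<lambda>p. - 2 * tensor f' (\<lambda>x. 1) p) (\<lambda>p. 0) (\<lambda>p. 2 * tensor f (\<lambda>x. 1) p)
      (\<lambda>p. - tensor f (\<lambda>x. 1) p))
    = - 2 * fourier f' (\<lambda>x. 1) a + 2 * fourier f (\<lambda>x. 1) c - 2 * fourier f (\<lambda>x. 1) d"
  using tensor_smooth_periodic[OF tf trig_pair_const] tensor_smooth_periodic[OF trig_pair_deriv[OF tf] trig_pair_const]
  by (simp add: l2_inner_def inner_frame_field_frame_field fourier_def integral_add integral_diff mult.left_commute[of _ 2])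

lemma l2_inner_mode01:
  assumes tg: "trig_pair n g g'" and [simp]: "a \<in> smooth_periodic" "b \<in> smooth_periodic" "c \<in> smooth_periodic" "d \<in> smooth_periodic"
  shows "l2_inner (frame_field a b c d) (frame_field (\<lambda>p. 0) (\<lambda>p. - 2 * tensor (\<lambda>x. 1) g' p) (\<lambda>p. 2 * tensor (\<lambda>x. 1) g p)
      (\<lambda>p. tensor (\<lambda>x. 1) g p))
    = - 2 * fourier (\<lambda>x. 1) g' b + 2 * fourier (\<lambda>x. 1) g c + 2 * fourier (\<lambda>x. 1) g d"
  using tensor_smooth_periodic[OF trig_pair_const tg] tensor_smooth_periodic[OF trig_pair_const trig_pair_deriv[OF tg]]
  by (simp add: l2_inner_def inner_frame_field_frame_field fourier_def integral_add integral_diff mult.left_commute[of _ 2])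

lemma l2_inner_mode00:
  assumes [simp]: "a \<in> smooth_periodic" "b \<in> smooth_periodic" "c \<in> smooth_periodic" "d \<in> smooth_periodic"
  shows "l2_inner (frame_field a b c d) (frame_field (\<lambda>p. r) (\<lambda>p. s) (\<lambda>p. 0) (\<lambda>p. t))
    = r * fourier (\<lambda>x. 1) (\<lambda>x. 1) a + s * fourier (\<lambda>x. 1) (\<lambda>x. 1) b + 2 * t * fourier (\<lambda>x. 1) (\<lambda>x. 1) d"
  by (simp add: l2_inner_def inner_frame_field_frame_field fourier_def tensor_def integral_add)

lemma small_modes:
  fixes m n :: nat
  assumes "(real m)\<^sup>2 + (real n)\<^sup>2 < 4"
  shows "m \<in> {0, 1} \<and> n \<in> {0, 1}"
proof -
  have "k < 2" if "(real k)\<^sup>2 < 4" for k :: nat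
    using that power2_less_imp_less[of "real k" 2] by simp
  moreover have "(real m)\<^sup>2 < 4" "(real n)\<^sup>2 < 4"
    using assms zero_le_power2[of "real m"] zero_le_power2[of "real n"] by linarith+
  ultimately show ?thesis by (simp add: less_2_cases_iff)
qed

lemma Ker_orthogonal_zero:
  assumes V: "V \<in> Ker_I2 \<Phi>" and orth: "\<And>i. i \<in> {1..10} \<Longrightarrow> l2_inner V (killing i) = 0" "l2_inner V V\<^sub>\<nu> = 0"
  shows "V = 0"
proof -
  obtain a b c d where eq: "V = frame_field a b c d" using Ker_I2_cases[OF V] .
  have K: "frame_field a b c d \<in> Ker_I2 \<Phi>" using V eq by simp
  have smooth_periodic [simp]: "a \<in> smooth_periodic" "b \<in> smooth_periodic" "c \<in> smooth_periodic" "d \<in> smooth_periodic"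
    using K by (auto simp: Ker_I2_frame_field)
  note sys = Ker_mode_system[OF K]
  have o: "l2_inner (frame_field a b c d) (killing 1) = 0" "l2_inner (frame_field a b c d) (killing 2) = 0" "l2_inner (frame_field a b c d) (killing 3) = 0" "l2_inner (frame_field a b c d) (killing 4) = 0"
    "l2_inner (frame_field a b c d) (killing 5) = 0" "l2_inner (frame_field a b c d) (killing 6) = 0" "l2_inner (frame_field a b c d) (killing 7) = 0" "l2_inner (frame_field a b c d) (killing 8) = 0"
    "l2_inner (frame_field a b c d) (killing 9) = 0" "l2_inner (frame_field a b c d) (killing 10) = 0" "l2_inner (frame_field a b c d) V\<^sub>\<nu> = 0"
    using orth unfolding eq by simp_all
  note o = o[unfolded killing_eq V\<^sub>\<nu>_eq l2_inner_scaleR_right]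
  have cs: "trig_pair 1 cos (\<lambda>x. - sin x)" "trig_pair 1 sin cos" by (rule trig_pair_simple)+
  \<comment> \<open>For x = y = 1 the system leaves the line \<alpha> = - \<beta> = \<delta>,
    \<kappa> = 0, on which the orthogonality form equals - 4 \<delta>.\<close>
  have m11: "fourier f' g a = 0 \<and> fourier f g' b = 0 \<and> fourier f g c = 0 \<and> fourier f g d = 0"
    if "(f, f') \<in> {(cos, \<lambda>x. - sin x), (sin, cos)}" "(g, g') \<in> {(cos, \<lambda>x. - sin x), (sin, cos)}" for f f' g g'
  proof -
    have t: "trig_pair 1 f f'" "trig_pair 1 g g'" using that cs by auto
    have "- fourier f' g a + fourier f g' b - 2 * fourier f g d = 0"
      using that o(3-6) l2_inner_mode11[OF t smooth_periodic] by auto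
    moreover note sys[OF t]
    ultimately show ?thesis by simp
  qed
  \<comment> \<open>For x = 1, y = 0 the system leaves the line \<alpha> = 2 \<delta>, \<kappa> = -
    2 \<delta>, on which the form equals - 10 \<delta>. In the mirrored mode below, the line is
    \<beta> = - 2 \<delta>, \<kappa> = 2 \<delta> and the form is 10 \<delta>.\<close>
  have m10: "fourier f' (\<lambda>x. 1) a = 0 \<and> fourier f (\<lambda>x. 1) c = 0 \<and> fourier f (\<lambda>x. 1) d = 0"
    if "(f, f') \<in> {(cos, \<lambda>x. - sin x), (sin, cos)}" for f f'
  proof -
    have t: "trig_pair 1 f f'" using that cs by auto
    have "- 2 * fourier f' (\<lambda>x. 1) a + 2 * fourier f (\<lambda>x. 1) c - 2 * fourier f (\<lambda>x. 1) d = 0"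
      using that o(7,8) l2_inner_mode10[OF t smooth_periodic] by auto
    moreover note sys[OF t trig_pair_const[of 1]]
    ultimately show ?thesis by simp
  qed
  have m01: "fourier (\<lambda>x. 1) g' b = 0 \<and> fourier (\<lambda>x. 1) g c = 0 \<and> fourier (\<lambda>x. 1) g d = 0"
    if "(g, g') \<in> {(cos, \<lambda>x. - sin x), (sin, cos)}" for g g'
  proof -
    have t: "trig_pair 1 g g'" using that cs by auto
    have "- 2 * fourier (\<lambda>x. 1) g' b + 2 * fourier (\<lambda>x. 1) g c + 2 * fourier (\<lambda>x. 1) g d = 0"
      using that o(9,10) l2_inner_mode01[OF t smooth_periodic] by auto
    moreover note sys[OF trig_pair_const[of 1] t]
    ultimately show ?thesis by simp
  qed
  \<comment> \<open>Orthogonality to the two circle rotations and to \<open>V\<^sub>\<nu>\<close>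
    kills the means of a, b and d; the mean of c vanishes by the third mode equation, which reads -
    \<kappa> = 0 here.\<close>
  have m00: "fourier (\<lambda>x. 1) (\<lambda>x. 1) a = 0" "fourier (\<lambda>x. 1) (\<lambda>x. 1) b = 0"
    "fourier (\<lambda>x. 1) (\<lambda>x. 1) c = 0" "fourier (\<lambda>x. 1) (\<lambda>x. 1) d = 0"
    using o(1,2,11) sys(3)[OF trig_pair_const[of 1] trig_pair_const[of 1]]
    by (simp_all add: l2_inner_mode00)
  have h0: "f = (\<lambda>x. 1) \<or> f = (\<lambda>x. 0)" if "f \<in> harmonics 0" for f
    using that by (auto simp: harmonics_def)
  have h1: "f = cos \<or> f = sin" if "f \<in> harmonics 1" for f
    using that by (auto simp: harmonics_def)
  have zero: "fourier f g a = 0 \<and> fourier f g b = 0 \<and> fourier f g c = 0 \<and> fourier f g d = 0"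
    if f: "f \<in> harmonics m" and g: "g \<in> harmonics n" for m n f g
  proof -
    obtain f' where tf: "trig_pair m f f'" using trig_pair_harmonics[OF f] .
    obtain g' where tg: "trig_pair n g g'" using trig_pair_harmonics[OF g] .
    note tf' = trig_pair_deriv[OF tf] and tg' = trig_pair_deriv[OF tg]
    have a: "fourier f g a = 0" if "m = 0" "n \<noteq> 0"
      using h0[of f] f that Ker_mode_constant(1)[OF K tg] by auto
    have b: "fourier f g b = 0" if "n = 0" "m \<noteq> 0"
      using h0[of g] g that Ker_mode_constant(2)[OF K tf] by auto
    show ?thesis
    proof (cases "(real m)\<^sup>2 + (real n)\<^sup>2 \<ge> 4")
      case True
      note reg = mode_system_regular[OF _ _ _ _ zero_le_power2 zero_le_power2 True]
      have "fourier f g c = 0" "fourier f g d = 0"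
        using reg(3,4)[OF sys[OF tf tg]] by auto
      \<comment> \<open>The system is applied with f' in place of f: its first unknown is then - m^2
        times the wanted coefficient. For m = 0 the fact \<open>a\<close> takes over.\<close>
      moreover have "fourier f g a = 0"
        using a True reg(1)[OF sys[OF tf' tg]] by (cases "m = 0"; cases "n = 0") auto
      moreover have "fourier f g b = 0"
        using b True reg(2)[OF sys[OF tf tg']] by (cases "n = 0"; cases "m = 0") auto
      ultimately show ?thesis by simp
    next
      case False
      then consider "m = 0" "n = 0" | "m = 1" "n = 0" | "m = 0" "n = 1" | "m = 1" "n = 1"
        using small_modes[of m n] by auto
      then show ?thesis
      proof cases
        case 1
        then show ?thesis using h0[of f] h0[of g] f g m00 by auto
      next
        case 2
        then show ?thesis using h1[of f] h0[of g] f g b m10[of cos "\<lambda>x. - sin x"] m10[of sin cos] by auto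
      next
        case 3
        then show ?thesis using h0[of f] h1[of g] f g a m01[of cos "\<lambda>x. - sin x"] m01[of sin cos] by auto
      next
        case 4
        then show ?thesis
          using h1[of f] h1[of g] f g m11[of cos "\<lambda>x. - sin x" cos "\<lambda>x. - sin x"]
            m11[of cos "\<lambda>x. - sin x" sin cos] m11[of sin cos cos "\<lambda>x. - sin x"] m11[of sin cos sin cos] by auto
      qed
    qed
  qed
  have "a = (\<lambda>p. 0)" "b = (\<lambda>p. 0)" "c = (\<lambda>p. 0)" "d = (\<lambda>p. 0)"
    by (rule Fourier_complete, simp, use zero in blast)+
  then show ?thesis by (auto simp: eq frame_field_def)
qed

section \<open>Orthogonality of the kernel fields\<close>

lemma integral_product:
  fixes f g :: "real \<Rightarrow> real"
  assumes "continuous_on UNIV f" "continuous_on UNIV g"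
  shows "integral period_cell (\<lambda>p. f (fst p) * g (snd p)) = integral {0..2*pi} f * integral {0..2*pi} g"
proof -
  have "continuous_on UNIV (\<lambda>p::torus. f (fst p))" "continuous_on UNIV (\<lambda>p::torus. g (snd p))"
    by (rule continuous_on_compose2[OF assms(1) continuous_on_fst[OF continuous_on_id]]
        continuous_on_compose2[OF assms(2) continuous_on_snd[OF continuous_on_id]]; simp)+
  then have "continuous_on period_cell (\<lambda>p. f (fst p) * g (snd p))"
    by (intro continuous_on_mult) (auto elim: continuous_on_subset)
  then show ?thesis
    by (subst integral_prod_continuous) simp_all
qed

lemma integral_trig:
  "integral {0..2*pi} cos = 0" "integral {0..2*pi} sin = 0"
  "integral {0..2*pi} (\<lambda>x. cos x * cos x) = pi" "integral {0..2*pi} (\<lambda>x. sin x * sin x) = pi"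
  "integral {0..2*pi} (\<lambda>x. sin x * cos x) = 0" "integral {0..2*pi} (\<lambda>x. cos x * sin x) = 0"
proof -
  have FTC: "integral {0..2*pi} f = F (2*pi) - F 0" if "\<And>x. (F has_real_derivative f x) (at x)" for f F :: "real \<Rightarrow> real"
    by (rule integral_unique, rule fundamental_theorem_of_calculus)
       (use that in \<open>auto simp: has_real_derivative_iff_has_vector_derivative[symmetric] intro: DERIV_subset\<close>)
  show "integral {0..2*pi} cos = 0"
    by (subst FTC[of sin]) (auto intro!: derivative_eq_intros)
  show "integral {0..2*pi} sin = 0"
    by (subst FTC[of "\<lambda>x. - cos x"]) (auto intro!: derivative_eq_intros)
  show "integral {0..2*pi} (\<lambda>x. cos x * cos x) = pi"
    by (subst FTC[of "\<lambda>x. (x + sin x * cos x) / 2"])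
       (auto intro!: derivative_eq_intros simp: sin_times_sin field_simps)
  show "integral {0..2*pi} (\<lambda>x. sin x * sin x) = pi"
    by (subst FTC[of "\<lambda>x. (x - sin x * cos x) / 2"])
       (auto intro!: derivative_eq_intros simp: sin_times_sin field_simps)
  show "integral {0..2*pi} (\<lambda>x. sin x * cos x) = 0" "integral {0..2*pi} (\<lambda>x. cos x * sin x) = 0"
    by (subst FTC[of "\<lambda>x. sin x * sin x / 2"]; auto intro!: derivative_eq_intros)+
qed

lemma integral_\<Phi>_\<Phi>:
  "integral period_cell (\<lambda>p. \<Phi> p $ r * \<Phi> p $ s) = (if r = s then if r = 5 then 2 * pi\<^sup>2 else pi\<^sup>2 / 2 else 0)"
proof -
  have 1: "integral period_cell (\<lambda>p. f (fst p)) = integral {0..2*pi} f * (2 * pi)" if "continuous_on UNIV f" for f :: "real \<Rightarrow> real"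
    using integral_product[OF that continuous_on_const[of _ 1]] by simp
  have 2: "integral period_cell (\<lambda>p. g (snd p)) = 2 * pi * integral {0..2*pi} g" if "continuous_on UNIV g" for g :: "real \<Rightarrow> real"
    using integral_product[OF continuous_on_const[of _ 1] that] by simp
  have 3: "integral period_cell (\<lambda>p. g (snd p) * f (fst p)) = integral {0..2*pi} f * integral {0..2*pi} g"
    if "continuous_on UNIV f" "continuous_on UNIV g" for f g :: "real \<Rightarrow> real"
    using integral_product[OF that] by (simp add: mult.commute)
  have 4: "integral period_cell (\<lambda>p. r) = 4 * pi\<^sup>2 * r" for r :: real
    using integral_product[of "\<lambda>x. 1" "\<lambda>x. r"] by (simp add: power2_eq_square)
  have 5: "Henstock_Kurzweil_Integration.content period_cell = 4 * pi\<^sup>2"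
    using 4[of 1] by simp
  note [simp] = integral_trig continuous_intros power2_eq_square
    1[of cos] 1[of sin] 1[of "\<lambda>x. cos x * cos x"] 1[of "\<lambda>x. sin x * sin x"]
    1[of "\<lambda>x. sin x * cos x"] 1[of "\<lambda>x. cos x * sin x"]
    2[of cos] 2[of sin] 2[of "\<lambda>x. cos x * cos x"] 2[of "\<lambda>x. sin x * sin x"]
    2[of "\<lambda>x. sin x * cos x"] 2[of "\<lambda>x. cos x * sin x"]
    3[of cos cos] 3[of cos sin] 3[of sin cos] 3[of sin sin]
    integral_product[of cos cos] integral_product[of cos sin] integral_product[of sin cos] integral_product[of sin sin]
  show ?thesis
    using exhaust_5[of r] exhaust_5[of s] by (elim disjE) (simp_all add: \<Phi>_nth 5)
qed

lemma linear_\<Phi>: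
  assumes "linear F" shows "F (\<Phi> p) = (\<Sum>r\<in>UNIV. \<Phi> p $ r *\<^sub>R F (axis r 1))"
proof -
  have "\<Phi> p = (\<Sum>r\<in>UNIV. \<Phi> p $ r *\<^sub>R axis r 1)"
    using basis_expansion[of "\<Phi> p"] by (simp add: scalar_mult_eq_scaleR)
  from arg_cong[OF this, of F] show ?thesis
    by (simp only: linear_sum[OF assms] linear_scale[OF assms])
qed

text \<open>The squared norms of the coordinate functions of \<open>\<Phi>\<close> are all equal to \<open>\<pi>\<^sup>2 / 2\<close>, except
  for the constant coordinate, which carries the factor four.\<close>

definition gram :: "(real ^ 5 \<Rightarrow> real ^ 5) \<Rightarrow> (real ^ 5 \<Rightarrow> real ^ 5) \<Rightarrow> real" where
  "gram F G = (\<Sum>r\<in>UNIV. (if r = 5 then 4 else 1) * (F (axis r 1) \<bullet> G (axis r 1)))"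

lemma smooth_\<Phi>: "smooth \<Phi>"
  by (simp add: \<Phi>_eq[abs_def])

text \<open>The coordinates of \<Phi> are pairwise orthogonal, so pairing two linear fields along
  \<Phi> is a weighted Hilbert-Schmidt product of matrices and no integral remains.\<close>

lemma l2_inner_linear_\<Phi>:
  assumes "linear F" "linear G"
  shows "l2_inner (F \<circ> \<Phi>) (G \<circ> \<Phi>) = pi\<^sup>2 / 2 * gram F G"
proof -
  have int: "(\<lambda>p. \<Phi> p $ r * \<Phi> p $ s * c) integrable_on period_cell" for r s c
    using smooth_continuous[OF smooth_\<Phi>]
    by (intro integrable_continuous continuous_intros) (auto elim: continuous_on_subset)
  have "l2_inner (F \<circ> \<Phi>) (G \<circ> \<Phi>) = integral period_cell (\<lambda>p. \<Sum>r\<in>UNIV. \<Sum>s\<in>UNIV.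
      \<Phi> p $ r * \<Phi> p $ s * (F (axis r 1) \<bullet> G (axis s 1)))"
    by (simp add: l2_inner_def linear_\<Phi>[OF assms(1)] linear_\<Phi>[OF assms(2)] inner_sum_left)
       (simp add: inner_sum_right sum_distrib_left mult.assoc)
  also have "\<dots> = (\<Sum>r\<in>UNIV. \<Sum>s\<in>UNIV. integral period_cell (\<lambda>p. \<Phi> p $ r * \<Phi> p $ s) * (F (axis r 1) \<bullet> G (axis s 1)))"
    using int by (simp add: integral_sum integrable_sum)
  also have "\<dots> = (\<Sum>r\<in>UNIV. \<Sum>s\<in>UNIV. if r = s then
      (if r = 5 then 2 * pi\<^sup>2 else pi\<^sup>2 / 2) * (F (axis r 1) \<bullet> G (axis r 1)) else 0)"
    unfolding integral_\<Phi>_\<Phi> by (intro sum.cong) auto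
  also have "\<dots> = pi\<^sup>2 / 2 * gram F G"
    by (simp add: gram_def sum_distrib_left) (intro sum.cong, auto)
  finally show ?thesis .
qed

text \<open>Index 11 presents \<open>V\<^sub>\<nu>\<close> too as a linear map along \<Phi>; the
  factor sqrt 2 arises from cos \<gamma> / sqrt 2 = sqrt 2 (cos \<gamma> / 2).\<close>

definition kernel_map :: "nat \<Rightarrow> real ^ 5 \<Rightarrow> real ^ 5" where
  "kernel_map i y = (if i = 11 then sqrt 2 *\<^sub>R vector [y$1, y$2, - y$3, - y$4, 0] else Z i y)"

lemma index_cases: "i \<in> {1..11::nat} \<Longrightarrow> i \<in> {1,2,3,4,5,6,7,8,9,10,11}"
  by simp presburger

lemma linear_vector_5:
  fixes a b c d e :: "real ^ 5 \<Rightarrow> real"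
  assumes "linear a" "linear b" "linear c" "linear d" "linear e"
  shows "linear (\<lambda>y. vector [a y, b y, c y, d y, e y] :: real ^ 5)"
  using assms by (intro linearI) (simp_all add: vec_eq_iff forall_5 linear_add linear_scale)

lemma linear_kernel_map:
  assumes "i \<in> {1..11}" shows "linear (kernel_map i)"
proof -
  have [intro]: "linear (\<lambda>y :: real ^ 5. y $ k)" "linear (\<lambda>y :: real ^ 5. - (y $ k))"
    "linear (\<lambda>y :: real ^ 5. 0 :: real)" for k
    by (auto intro: linearI)
  show ?thesis
    using index_cases[OF assms]
    by (elim insertE emptyE)
       (auto simp: kernel_map_def[abs_def] intro!: linear_vector_5 linear_compose_scale_right)
qed

lemma kernel_map_\<Phi>: "i \<in> {1..10} \<Longrightarrow> kernel_map i \<circ> \<Phi> = killing i" "kernel_map 11 \<circ> \<Phi> = V\<^sub>\<nu>"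
proof -
  show "kernel_map i \<circ> \<Phi> = killing i" if "i \<in> {1..10}"
    using that by (simp add: fun_eq_iff kernel_map_def del: Z_simps)
  have s: "x * 2 / sqrt 2 = sqrt 2 * x" for x
    by (simp add: field_simps)
  show "kernel_map 11 \<circ> \<Phi> = V\<^sub>\<nu>"
    by (rule ext) (simp add: kernel_map_def V\<^sub>\<nu>_def vec_eq_iff forall_5 \<Phi>_nth s split_beta)
qed

lemma UNIV_5: "(UNIV :: 5 set) = {1, 2, 3, 4, 5}"
proof (rule set_eqI)
  show "i \<in> UNIV \<longleftrightarrow> i \<in> {1, 2, 3, 4, 5}" for i :: 5
    using exhaust_5[of i] by simp
qed

lemma ne_5: "(1::5) \<noteq> 2" "(1::5) \<noteq> 3" "(1::5) \<noteq> 4" "(1::5) \<noteq> 5" "(2::5) \<noteq> 3" "(2::5) \<noteq> 4" "(2::5) \<noteq> 5"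
    "(3::5) \<noteq> 4" "(3::5) \<noteq> 5" "(4::5) \<noteq> 5"
    by simp_all

lemma sum_5: "sum f (UNIV :: 5 set) = f 1 + f 2 + f 3 + f 4 + f 5"
  unfolding UNIV_5 by (simp only: sum.insert finite.intros insert_iff empty_iff ne_5 simp_thms sum.empty add_0_right add.assoc)

lemma axis_nth_5: "axis r (1 :: real) $ s = (if r = s then 1 else 0)" for r s :: 5
  by (auto simp: axis_def)

lemma inner_5: "v \<bullet> w = v$1 * w$1 + v$2 * w$2 + v$3 * w$3 + v$4 * w$4 + v$5 * w$5"
  for v w :: "real ^ 5"
  by (simp only: inner_vec_def sum_5 inner_real_def)

text \<open>Keeping G arbitrary reduces the 121 Gram entries to eleven formulas; the 4 is the weight
  of the constant coordinate.\<close>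

lemma gram_kernel_map_left:
  "gram (kernel_map 1) G = G (axis 1 1) $ 2 - G (axis 2 1) $ 1"
  "gram (kernel_map 2) G = G (axis 3 1) $ 4 - G (axis 4 1) $ 3"
  "gram (kernel_map 3) G = G (axis 1 1) $ 4 - G (axis 4 1) $ 1"
  "gram (kernel_map 4) G = G (axis 2 1) $ 3 - G (axis 3 1) $ 2"
  "gram (kernel_map 5) G = G (axis 1 1) $ 3 - G (axis 3 1) $ 1"
  "gram (kernel_map 6) G = G (axis 2 1) $ 4 - G (axis 4 1) $ 2"
  "gram (kernel_map 7) G = G (axis 2 1) $ 5 - 4 * G (axis 5 1) $ 2"
  "gram (kernel_map 8) G = G (axis 1 1) $ 5 - 4 * G (axis 5 1) $ 1"
  "gram (kernel_map 9) G = G (axis 4 1) $ 5 - 4 * G (axis 5 1) $ 4"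
  "gram (kernel_map 10) G = G (axis 3 1) $ 5 - 4 * G (axis 5 1) $ 3"
  "gram (kernel_map 11) G = sqrt 2 * (G (axis 1 1) $ 1 + G (axis 2 1) $ 2 - G (axis 3 1) $ 3 - G (axis 4 1) $ 4)"
  by (simp_all add: gram_def sum_5 kernel_map_def inner_5 axis_nth_5 algebra_simps)

text \<open>The equivalence carries both orthogonality and nonvanishing norms; the latter also shows
  that distinct indices give distinct fields.\<close>

lemma gram_kernel_map:
  assumes "i \<in> {1..11}" "j \<in> {1..11}"
  shows "gram (kernel_map i) (kernel_map j) = 0 \<longleftrightarrow> i \<noteq> j"
proof -
  have "\<forall>j\<in>{1,2,3,4,5,6,7,8,9,10,11}. gram (kernel_map i) (kernel_map j) = 0 \<longleftrightarrow> i \<noteq> j"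
    using index_cases[OF assms(1)]
    by (elim insertE emptyE; simp only: gram_kernel_map_left; simp del: One_nat_def add: kernel_map_def axis_nth_5)
  then show ?thesis using index_cases[OF assms(2)] by (rule bspec)
qed

section \<open>The kernel as the span of eleven orthogonal fields\<close>

definition kernel_basis :: "(torus \<Rightarrow> real ^ 5) set" where "kernel_basis = (\<lambda>i. kernel_map i \<circ> \<Phi>) ` {1..11}"

lemma kernel_basis_eq: "kernel_basis = insert V\<^sub>\<nu> ((\<lambda>i. killing i) ` {1..10})"
proof -
  have "{1..11} = insert 11 {1..10::nat}" by auto
  then show ?thesis unfolding kernel_basis_def using kernel_map_\<Phi> by auto
qed

lemma l2_inner_kernel_basis: "V \<in> kernel_basis \<Longrightarrow> W \<in> kernel_basis \<Longrightarrow> l2_inner V W = 0 \<longleftrightarrow> V \<noteq> W"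
proof -
  have "l2_inner (kernel_map i \<circ> \<Phi>) (kernel_map j \<circ> \<Phi>) = 0 \<longleftrightarrow> i \<noteq> j" if "i \<in> {1..11}" "j \<in> {1..11}" for i j
    using that by (simp add: l2_inner_linear_\<Phi> linear_kernel_map gram_kernel_map)
  then show "V \<in> kernel_basis \<Longrightarrow> W \<in> kernel_basis \<Longrightarrow> l2_inner V W = 0 \<longleftrightarrow> V \<noteq> W"
    unfolding kernel_basis_def by (smt (verit) imageE)
qed

lemma inj_on_kernel_map: "inj_on (\<lambda>i. kernel_map i \<circ> \<Phi>) {1..11}"
proof (rule inj_onI)
  fix i j :: nat assume ij: "i \<in> {1..11}" "j \<in> {1..11}" and eq: "kernel_map i \<circ> \<Phi> = kernel_map j \<circ> \<Phi>"
  have "pi\<^sup>2 / 2 * gram (kernel_map i) (kernel_map i) = pi\<^sup>2 / 2 * gram (kernel_map i) (kernel_map j)"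
    using l2_inner_linear_\<Phi>[OF linear_kernel_map linear_kernel_map] ij eq by metis
  then have "gram (kernel_map i) (kernel_map i) = gram (kernel_map i) (kernel_map j)" by simp
  then show "i = j" using ij gram_kernel_map by metis
qed

lemma kernel_basis_Ker: "kernel_basis \<subseteq> Ker_I2 \<Phi>"
  using killing_in_Ker V\<^sub>\<nu>_in_Ker by (auto simp: kernel_basis_eq)

text \<open>Additivity of the integral requires integrability, which kernel elements provide by
  smoothness; hence the restriction to the kernel.\<close>

lemma l2_inner_linear:
  assumes "V \<in> Ker_I2 \<Phi>" "V' \<in> Ker_I2 \<Phi>" "W \<in> Ker_I2 \<Phi>"
  shows "l2_inner (V + V') W = l2_inner V W + l2_inner V' W" "l2_inner (V - V') W = l2_inner V W - l2_inner V' W"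
    "l2_inner (r *\<^sub>R V) W = r * l2_inner V W"
proof -
  have int: "(\<lambda>p. U p \<bullet> W p) integrable_on period_cell" if "U \<in> Ker_I2 \<Phi>" for U
  proof -
    have "smooth U" "smooth W" using that assms(3) by (auto simp: Ker_I2_def sections_def)
    then have "continuous_on UNIV (\<lambda>p. U p \<bullet> W p)" by (simp add: smooth_continuous)
    then show ?thesis using integrable_continuous continuous_on_subset by blast
  qed
  show "l2_inner (V + V') W = l2_inner V W + l2_inner V' W" "l2_inner (V - V') W = l2_inner V W - l2_inner V' W"
    "l2_inner (r *\<^sub>R V) W = r * l2_inner V W"
    using int assms by (simp_all add: l2_inner_def inner_add_left inner_diff_left scaleR_fun_def integral_add integral_diff)
qed

lemma l2_inner_sum:
  assumes "finite J" "J \<subseteq> Ker_I2 \<Phi>" "W \<in> Ker_I2 \<Phi>"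
  shows "l2_inner (\<Sum>V\<in>J. c V *\<^sub>R V) W = (\<Sum>V\<in>J. c V * l2_inner V W)"
  using assms(1,2)
proof (induction J)
  case empty
  then show ?case by (simp add: l2_inner_def)
next
  case (insert V J)
  have J: "(\<Sum>V\<in>J. c V *\<^sub>R V) \<in> Ker_I2 \<Phi>" and V: "V \<in> Ker_I2 \<Phi>"
    using insert.prems by (auto intro!: subspace_sum subspace_scale subspace_Ker_I2)
  have IH: "l2_inner (\<Sum>V\<in>J. c V *\<^sub>R V) W = (\<Sum>V\<in>J. c V * l2_inner V W)"
    using insert.IH insert.prems by blast
  show ?case
    by (simp only: sum.insert[OF insert.hyps] IH l2_inner_linear(3)[OF V V assms(3)]
        l2_inner_linear(1)[OF subspace_scale[OF subspace_Ker_I2 V] J assms(3)])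
qed

text \<open>A member in the span of the others would be orthogonal to itself. The orthogonal
  complement is taken inside the kernel, where the pairing is linear.\<close>

lemma independent_kernel_basis: "independent kernel_basis"
proof
  assume "dependent kernel_basis"
  then obtain V where V: "V \<in> kernel_basis" "V \<in> span (kernel_basis - {V})" by (auto simp: dependent_def)
  have "subspace {W \<in> Ker_I2 \<Phi>. l2_inner W V = 0}"
  proof (rule subspaceI)
    show "0 \<in> {W \<in> Ker_I2 \<Phi>. l2_inner W V = 0}"
      using subspace_0[OF subspace_Ker_I2] by (simp add: l2_inner_def)
  qed (use V(1) kernel_basis_Ker in \<open>auto simp: l2_inner_linear subspace_add[OF subspace_Ker_I2] subspace_scale[OF subspace_Ker_I2]\<close>)
  moreover have "kernel_basis - {V} \<subseteq> {W \<in> Ker_I2 \<Phi>. l2_inner W V = 0}"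
    using V(1) kernel_basis_Ker l2_inner_kernel_basis by auto
  ultimately have "l2_inner V V = 0" using V(2) span_minimal by blast
  then show False using l2_inner_kernel_basis V(1) by blast
qed

lemma Ker_I2_eq_span: "Ker_I2 \<Phi> = span kernel_basis"
proof
  show "span kernel_basis \<subseteq> Ker_I2 \<Phi>" by (rule span_minimal[OF kernel_basis_Ker subspace_Ker_I2])
  show "Ker_I2 \<Phi> \<subseteq> span kernel_basis"
  proof
    fix V assume V: "V \<in> Ker_I2 \<Phi>"
    define W where "W = (\<Sum>U\<in>kernel_basis. (l2_inner V U / l2_inner U U) *\<^sub>R U)"
    have fin: "finite kernel_basis" by (simp add: kernel_basis_def)
    have W: "W \<in> span kernel_basis" unfolding W_def by (intro span_sum span_scale span_base)
    then have WK: "W \<in> Ker_I2 \<Phi>" using span_minimal[OF kernel_basis_Ker subspace_Ker_I2] by blast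
    have "l2_inner (V - W) U = 0" if U: "U \<in> kernel_basis" for U
    proof -
      have "l2_inner W U = (\<Sum>U'\<in>kernel_basis. l2_inner V U' / l2_inner U' U' * l2_inner U' U)"
        using l2_inner_sum[OF fin kernel_basis_Ker, of U "\<lambda>U. l2_inner V U / l2_inner U U"] U kernel_basis_Ker unfolding W_def by blast
      \<comment> \<open>By orthogonality only U' = U contributes, and its quotient cancels because
        the squared norm of U is nonzero.\<close>
      also have "\<dots> = (\<Sum>U'\<in>kernel_basis. if U' = U then l2_inner V U else 0)"
        using U l2_inner_kernel_basis by (intro sum.cong refl) (auto split: if_splits)
      also have "\<dots> = l2_inner V U" using U fin by simp
      finally show ?thesis using l2_inner_linear(2)[OF V WK] U kernel_basis_Ker by auto
    qed
    moreover have "V - W \<in> Ker_I2 \<Phi>" using V WK by (rule subspace_diff[OF subspace_Ker_I2])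
    ultimately have "V - W = 0" by (intro Ker_orthogonal_zero) (auto simp: kernel_basis_eq)
    then show "V \<in> span kernel_basis" using W by simp
  qed
qed

theorem theorem3p1:
  shows "Ker_I2 \<Phi> = {A + B | A B. A \<in> W10 \<and> B \<in> W1} \<and> W10 \<inter> W1 = {0}
       \<and> dim W10 = 10 \<and> dim W1 = 1"
proof -
  let ?K = "(\<lambda>i. Z i \<circ> \<Phi>) ` {1..10}"
  \<comment> \<open>Injectivity makes the ten indices ten distinct fields; together with
    independence this yields the dimension.\<close>
  have inj: "inj_on (\<lambda>i. kernel_map i \<circ> \<Phi>) {1..10}"
    using inj_on_subset[OF inj_on_kernel_map] by fastforce
  have K: "?K = (\<lambda>i. kernel_map i \<circ> \<Phi>) ` {1..10}" using kernel_map_\<Phi>(1) by auto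
  have notin: "V\<^sub>\<nu> \<notin> ?K"
  proof
    assume "V\<^sub>\<nu> \<in> ?K"
    then obtain i :: nat where "i \<in> {1..10}" "kernel_map 11 \<circ> \<Phi> = kernel_map i \<circ> \<Phi>" using kernel_map_\<Phi> by auto
    then show False using inj_onD[OF inj_on_kernel_map, of 11 i] by auto
  qed
  have ind: "independent (insert V\<^sub>\<nu> ?K)" using independent_kernel_basis kernel_basis_eq by simp
  then have indep: "independent ?K" "independent {V\<^sub>\<nu>}" "V\<^sub>\<nu> \<notin> span ?K"
    using notin independent_insert[of "V\<^sub>\<nu>" ?K] independent_mono[OF ind, of "{V\<^sub>\<nu>}"] by auto
  have "Ker_I2 \<Phi> = span (?K \<union> {V\<^sub>\<nu>})" by (simp add: Ker_I2_eq_span kernel_basis_eq)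
  then have "Ker_I2 \<Phi> = {A + B | A B. A \<in> W10 \<and> B \<in> W1}"
    unfolding span_Un W10_def W1_def by simp
  moreover have "W10 \<inter> W1 = {0}"
  proof -
    \<comment> \<open>A nonzero multiple of \<open>V\<^sub>\<nu>\<close> in the span of the Killing
      fields would put \<open>V\<^sub>\<nu>\<close> itself there, against independence.\<close>
    have "A = 0" if A: "A \<in> span ?K" "A \<in> span {V\<^sub>\<nu>}" for A
    proof -
      obtain r where r: "A = r *\<^sub>R V\<^sub>\<nu>" using A(2) by (auto simp: span_singleton)
      have "r = 0"
      proof (rule ccontr)
        assume "r \<noteq> 0"
        then have "V\<^sub>\<nu> = inverse r *\<^sub>R A" by (simp add: r)
        then show False using indep(3) span_scale[OF A(1)] by metis
      qed
      then show ?thesis by (simp add: r)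
    qed
    then show ?thesis by (auto simp: W10_def W1_def span_0)
  qed
  moreover have "dim W10 = 10"
    unfolding W10_def dim_span using dim_eq_card_independent[OF indep(1)] card_image[OF inj] K by simp
  moreover have "dim W1 = 1"
    unfolding W1_def dim_span using dim_eq_card_independent[OF indep(2)] by simp
  ultimately show ?thesis by blast
qed

end
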